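(* Let $R\in(0,\infty)$ and let $M:\mathbb{R}\to\mathbb{R}$ be an Orlicz function. Define $\varphi:(-\infty,0)\to\mathbb{R}$ by $\varphi(\alpha)=\log\int_{\mathbb{R}}e^{\alpha M(x)}\,\mathrm{d}x$, let $\alpha_*<0$ be chosen in such a way that $\varphi'(\alpha_* )=R$, and put $\sigma_*^2:=\varphi''(\alpha_* )$. Then, as $d\to\infty$, $$\mathrm{vol}_d\big(B_M^d(dR)\big)^{1/d}\to e^{\varphi(\alpha_* )-\alpha_*R},$$ i.e., on a logarithmic scale, $$\lim_{d\to\infty}\frac1d\log \mathrm{vol}_d\big(B_M^d(dR)\big)=\varphi(\alpha_* )-\alpha_*R,$$ and the precise asymptotic volume is given by $$\mathrm{vol}_d\big(B_M^d(dR)\big)\sim\frac{1}{|\alpha_*|\sqrt{2\pi d\,\sigma_*^2}}\,e^{d[\varphi(\alpha_* )-\alpha_*R]}.$$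
   Context: An Orlicz function is a convex function $M:\mathbb{R}\to\mathbb{R}$ with $M(t)=M(-t)$ for all $t$, $M(0)=0$, and $M(t)>0$ for $t\neq0$. For such $M$ the integral $\int_{\mathbb{R}}e^{-aM(x)}\,\mathrm{d}x$ is finite for every $a>0$ and infinitely differentiable as a function of $a\in(0,\infty)$. For $d\in\mathbb{N}$ and $R\in(0,\infty)$, the Orlicz ball is $$B_M^d(dR)=\Big\{x=(x_i)_{i=1}^d\in\mathbb{R}^d:\ \sum_{i=1}^dM(x_i)\le dR\Big\}.$$ $\mathrm{vol}_d$ denotes $d$-dimensional Lebesgue measure. For real sequences, $a_d\sim b_d$ means $\lim_{d\to\infty}a_d/b_d=1$. *)

theory Defs
  imports "HOL-Analysis.Analysis"
begin

definition orlicz_function :: "(real \<Rightarrow> real) \<Rightarrow> bool" where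
  "orlicz_function M \<longleftrightarrow>
     convex_on UNIV M \<and> (\<forall>t. M t = M (- t)) \<and> M 0 = 0 \<and> (\<forall>t. t \<noteq> 0 \<longrightarrow> M t > 0)"

text \<open>
  Since the dimension varies along the sequence, \<open>\<real>\<^sup>d\<close> is modelled by the extensional functions
  on \<open>{..<d}\<close>, which form the underlying space of the product measure used for \<open>vol\<close>.
\<close>

definition orlicz_ball :: "(real \<Rightarrow> real) \<Rightarrow> nat \<Rightarrow> real \<Rightarrow> (nat \<Rightarrow> real) set" where
  "orlicz_ball M d r = {x \<in> {..<d} \<rightarrow>\<^sub>E UNIV. (\<Sum>i<d. M (x i)) \<le> r}"

definition vol :: "nat \<Rightarrow> (nat \<Rightarrow> real) set \<Rightarrow> real" where
  "vol d A = measure (Pi\<^sub>M {..<d} (\<lambda>_. lborel)) A"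

text \<open>Only meaningful for \<open>\<alpha> < 0\<close>, where the integral is finite and positive.\<close>

definition orlicz_phi :: "(real \<Rightarrow> real) \<Rightarrow> real \<Rightarrow> real" where
  "orlicz_phi M \<alpha> = ln (\<integral>x. exp (\<alpha> * M x) \<partial>lborel)"

end

theory Submission
  imports Defs "HOL-Probability.Probability" "HOL-Real_Asymp.Real_Asymp"
begin

text \<open>
  Tilting Lebesgue measure by \<open>exp (\<alpha> * M x - \<phi> \<alpha>)\<close> makes the coordinates independent
  random variables for which \<open>M x\<close> has mean \<open>R\<close> and variance \<open>\<sigma>2\<close>. With \<open>T\<close> the centred sum
  of the \<open>M (x i)\<close>, the volume is \<open>exp (d * (\<phi> \<alpha> - \<alpha> * R))\<close> times the expectation of
  \<open>exp (- \<alpha> * T)\<close> on the event \<open>T \<le> 0\<close>. The latter is handled by a local limit theorem: after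
  scaling by \<open>sqrt d\<close> the law of \<open>T\<close> looks locally like Lebesgue measure with density
  \<open>1 / sqrt (2 * pi * \<sigma>2)\<close>. To see this, weight the laws by a positive integrable kernel whose
  Fourier transform has compact support. The characteristic functions of the weighted laws then only
  involve those of \<open>T\<close> on a bounded set, where dominated convergence applies, and Levy's
  continuity theorem gives weak convergence.
\<close>

section \<open>A positive kernel with compactly supported Fourier transform\<close>

text \<open>
  The Fourier transform of the unsquared tent function has zeros; squaring makes it strictly positive.
\<close>

definition tent :: "real \<Rightarrow> real" where
  "tent u = (max 0 (1 - \<bar>u\<bar>))\<^sup>2"

text \<open>Closed form of the Fourier transform of \<open>tent\<close>, as
  \<open>integral_tent_cos\<close> confirms. The value \<open>2/3\<close> at 0 is the integral of
  \<open>tent\<close>.\<close>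

definition tent_ft :: "real \<Rightarrow> real" where
  "tent_ft t = (if t = 0 then 2/3 else 4 * (t - sin t) / t ^ 3)"

lemma tent_bounds: "0 \<le> tent u" "tent u \<le> 1"
  by (auto simp: tent_def max_def power_le_one)

lemma tent_eq_0: "\<bar>u\<bar> \<ge> 1 \<Longrightarrow> tent u = 0" by (auto simp: tent_def max_def)

lemma continuous_tent [continuous_intros]: "continuous_on A f \<Longrightarrow> continuous_on A (\<lambda>x. tent (f x))"
  unfolding tent_def by (intro continuous_intros) auto

lemma tent_measurable [measurable]: "tent \<in> borel_measurable borel"
  by (intro borel_measurable_continuous_onI continuous_intros)

lemma tent_ft_measurable [measurable]: "tent_ft \<in> borel_measurable borel"
  unfolding tent_ft_def[abs_def] by measurable

lemma tent_ft_minus [simp]: "tent_ft (- t) = tent_ft t"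
  by (auto simp: tent_ft_def divide_simps)

text \<open>This allows the kernel to be divided out later: a function of size
  \<open>B / (1 + x^2)\<close> stays bounded after division by \<open>tent_ft\<close>. Near 0 a
  Taylor estimate gives the bound, farther out \<open>sin t <= 1\<close> does.\<close>

lemma tent_ft_lower: "tent_ft t \<ge> 2 / 5 / (1 + t\<^sup>2)"
proof -
  have *: "tent_ft t \<ge> 2 / 5 / (1 + t\<^sup>2)" if t: "t > 0" for t :: real
  proof (cases "t \<le> 2")
    case True
    have p: "t ^ 5 = t ^ 3 * t\<^sup>2" by (simp flip: power_add)
    have "\<bar>sin t - (\<Sum>m<5. sin_coeff m * t ^ m)\<bar> \<le> inverse (fact 5) * \<bar>t\<bar> ^ 5"
      by (rule Maclaurin_sin_bound)
    moreover have "{..<5} = {0, 1, 2, 3, 4 :: nat}" by auto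
    ultimately have "\<bar>sin t - (t - t ^ 3 / 6)\<bar> \<le> t ^ 5 / 120"
      using t by (simp add: sin_coeff_def fact_numeral)
    \<comment> \<open>For \<open>t <= 2\<close> the remainder \<open>t^5 / 120\<close> is at most
      \<open>t^3 / 30\<close>, which leaves at least \<open>t^3 / 10\<close> of the leading term
      \<open>t^3 / 6\<close>.\<close>
    moreover have "t ^ 5 \<le> t ^ 3 * 4"
      using t True power_mono[of t 2 2] unfolding p by (intro mult_left_mono) auto
    ultimately have "t - sin t \<ge> t ^ 3 / 10" by linarith
    then have "tent_ft t \<ge> 2 / 5"
      using t by (simp add: tent_ft_def field_simps)
    moreover have "2 / 5 / (1 + t\<^sup>2) \<le> 2 / 5 / 1"
      by (intro divide_left_mono) (auto simp: add_pos_nonneg)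
    ultimately show ?thesis by linarith
  next
    case False
    then have "t - sin t \<ge> t / 2"
      using sin_le_one[of t] by linarith
    then have "tent_ft t \<ge> 4 * (t / 2) / t ^ 3"
      unfolding tent_ft_def using t by (auto intro!: divide_right_mono)
    also have "4 * (t / 2) / t ^ 3 = 2 / t\<^sup>2"
      using t by (simp add: field_simps eval_nat_numeral)
    also have "2 / t\<^sup>2 \<ge> 2 / 5 / (1 + t\<^sup>2)"
      using t by (intro frac_le) auto
    finally show ?thesis .
  qed
  show ?thesis
    using *[of t] *[of "-t"] by (cases t "0 :: real" rule: linorder_cases) (auto simp: tent_ft_def[of 0])
qed

lemma tent_ft_pos: "tent_ft t > 0"
proof -
  have "0 < 2 / 5 / (1 + t\<^sup>2)" by (simp add: add_pos_nonneg)
  then show ?thesis using tent_ft_lower[of t] by linarith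
qed

text \<open>This yields integrability of the kernel. The 16 comes from the bound
  \<open>8 / t^2\<close> together with \<open>1 + t^2 <= 2 * t^2\<close> for
  \<open>t >= 1\<close>.\<close>

lemma tent_ft_upper: "tent_ft t \<le> 16 / (1 + t\<^sup>2)"
proof -
  have *: "tent_ft t \<le> 16 / (1 + t\<^sup>2)" if t: "t > 0" for t :: real
  proof (cases "t \<le> 1")
    case True
    have "\<bar>sin t - (\<Sum>m<3. sin_coeff m * t ^ m)\<bar> \<le> inverse (fact 3) * \<bar>t\<bar> ^ 3"
      by (rule Maclaurin_sin_bound)
    moreover have "{..<3} = {0, 1, 2 :: nat}" by auto
    ultimately have "\<bar>sin t - t\<bar> \<le> t ^ 3 / 6"
      using t by (simp add: sin_coeff_def fact_numeral)
    then have "t - sin t \<le> t ^ 3 / 6" by linarith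
    then have "tent_ft t \<le> 2 / 3"
      using t by (simp add: tent_ft_def field_simps)
    moreover have "8 \<le> 16 / (1 + t\<^sup>2)"
      using t True by (simp add: field_simps power_le_one add_pos_pos)
    ultimately show ?thesis by linarith
  next
    case False
    then have "t - sin t \<le> 2 * t"
      using sin_ge_minus_one[of t] by linarith
    then have "tent_ft t \<le> 4 * (2 * t) / t ^ 3"
      unfolding tent_ft_def using t by (auto intro!: divide_right_mono)
    also have "4 * (2 * t) / t ^ 3 = 8 / t\<^sup>2"
      using t by (simp add: field_simps eval_nat_numeral)
    also have "8 / t\<^sup>2 \<le> 16 / (1 + t\<^sup>2)"
      using t False by (simp add: field_simps add_pos_pos)
    finally show ?thesis .
  qed
  show ?thesis
    using *[of t] *[of "-t"] by (cases t "0 :: real" rule: linorder_cases) (auto simp: tent_ft_def[of 0])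
qed

lemma tent_ft_le: "tent_ft t \<le> 16"
proof -
  have "16 / (1 + t\<^sup>2) \<le> 16 / 1" by (intro divide_left_mono) (auto simp: add_pos_nonneg)
  then show ?thesis using tent_ft_upper[of t] by simp
qed

lemma integrable_inverse_1_plus_square: "integrable lborel (\<lambda>x::real. 1 / (1 + x\<^sup>2))"
proof -
  have 1: "has_bochner_integral lborel (\<lambda>x. indicator {0..} x *\<^sub>R (1 / (1 + x\<^sup>2))) (pi / 2)"
  proof -
    have "has_bochner_integral lborel (\<lambda>x. indicator {0<..} x *\<^sub>R (1 / (1 + x\<^sup>2))) (pi / 2)"
      using integrable_I0i_1_div_plus_square LBINT_I0i_1_div_plus_square
      by (simp add: has_bochner_integral_iff interval_lebesgue_integrable_def interval_lebesgue_integral_def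
        set_integrable_def set_lebesgue_integral_def zero_ereal_def)
    also have "?this \<longleftrightarrow> ?thesis"
      by (rule has_bochner_integral_discrete_difference[where X = "{0}"]) (auto simp: indicator_def)
    finally show ?thesis .
  qed
  have "has_bochner_integral lborel (\<lambda>x::real. 1 / (1 + x\<^sup>2)) (2 *\<^sub>R (pi / 2))"
    by (rule has_bochner_integral_even_function[OF 1]) simp
  then show ?thesis by (simp add: has_bochner_integral_iff)
qed

lemma integrable_tent_ft: "integrable lborel tent_ft"
proof -
  have "integrable lborel (\<lambda>x::real. 16 * (1 / (1 + x\<^sup>2)))"
    by (intro integrable_mult_right integrable_inverse_1_plus_square)
  then show ?thesis
    by (rule Bochner_Integration.integrable_bound)
       (use tent_ft_upper tent_ft_pos in \<open>auto simp: less_imp_le\<close>)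
qed

lemma integrable_tent: "integrable lborel tent"
proof -
  have "integrable lborel (\<lambda>x. indicator {-1..1} x *\<^sub>R tent x)"
    by (rule borel_integrable_compact) (auto intro!: continuous_intros)
  also have "(\<lambda>x. indicator {-1..1} x *\<^sub>R tent x) = tent"
    using tent_eq_0 by (force simp: fun_eq_iff indicator_def)
  finally show ?thesis .
qed

lemma integral_tent_cos: "has_bochner_integral lborel (\<lambda>u. tent u * cos (t * u)) (tent_ft t)"
proof -
  \<comment> \<open>An antiderivative of \<open>(1 - u)^2 * cos (t * u)\<close>, found by
    integrating by parts twice. The divisions by \<open>t\<close> force a separate formula for
    \<open>t = 0\<close>.\<close>
  define F where "F u = (if t = 0 then - ((1 - u) ^ 3 / 3) else
     (1 - u)\<^sup>2 * sin (t * u) / t - 2 * (1 - u) * cos (t * u) / t\<^sup>2 - 2 * sin (t * u) / t ^ 3)" for u :: real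
  have "has_bochner_integral lborel (\<lambda>u. ((1 - u)\<^sup>2 * cos (t * u)) * indicator {0..1} u) (F 1 - F 0)"
  proof (rule has_bochner_integral_FTC_Icc_real)
    fix u :: real assume "0 \<le> u" "u \<le> 1"
    show "DERIV F u :> (1 - u)\<^sup>2 * cos (t * u)"
    proof (cases "t = 0")
      case True
      then show ?thesis unfolding F_def by (auto intro!: derivative_eq_intros)
    next
      case False
      then show ?thesis unfolding F_def
        by (auto intro!: derivative_eq_intros simp: field_simps eval_nat_numeral)
    qed
  qed (auto intro!: continuous_intros)
  also have "(\<lambda>u. ((1 - u)\<^sup>2 * cos (t * u)) * indicator {0..1} u) =
      (\<lambda>u. indicator {0..} u *\<^sub>R (tent u * cos (t * u)))"
    by (auto simp: fun_eq_iff indicator_def tent_def max_def)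
  finally have "has_bochner_integral lborel (\<lambda>u. tent u * cos (t * u)) (2 *\<^sub>R (F 1 - F 0))"
    by (rule has_bochner_integral_even_function) (simp add: tent_def)
  also have "2 *\<^sub>R (F 1 - F 0) = tent_ft t"
    by (auto simp: F_def tent_ft_def field_simps eval_nat_numeral)
  finally show ?thesis .
qed

text \<open>The cosine part is \<open>integral_tent_cos\<close>; the sine part vanishes because
  \<open>tent\<close> is even.\<close>

lemma integral_tent_iexp: "(CLBINT u. tent u * iexp (t * u)) = tent_ft t"
proof -
  have s: "integrable lborel (\<lambda>u. tent u * sin (t * u))"
    by (rule Bochner_Integration.integrable_bound[OF integrable_tent])
       (auto simp: abs_mult tent_bounds intro!: mult_left_le)
  have "has_bochner_integral lborel (\<lambda>u. indicator {0..} u *\<^sub>R (tent u * sin (t * u)))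
      (LBINT u. indicator {0..} u *\<^sub>R (tent u * sin (t * u)))"
    by (intro has_bochner_integral_integrable integrable_mult_indicator s) auto
  then have 1: "has_bochner_integral lborel (\<lambda>u. tent u * sin (t * u)) 0"
    by (rule has_bochner_integral_odd_function) (simp add: tent_def)
  have "has_bochner_integral lborel (\<lambda>u. complex_of_real (tent u * cos (t * u)) + \<i> * complex_of_real (tent u * sin (t * u))) (complex_of_real (tent_ft t) + \<i> * complex_of_real 0)"
    by (intro has_bochner_integral_add has_bochner_integral_mult_right has_bochner_integral_of_real 1 integral_tent_cos)
  also have "(\<lambda>u. complex_of_real (tent u * cos (t * u)) + \<i> * complex_of_real (tent u * sin (t * u))) =
     (\<lambda>u. tent u * iexp (t * u))"
    by (auto simp: fun_eq_iff exp_Euler cos_of_real sin_of_real algebra_simps simp flip: of_real_mult)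
  finally show ?thesis by (simp add: has_bochner_integral_iff)
qed

section \<open>Characteristic functions of centred sums\<close>

lemma has_bochner_integral_gauss:
  assumes c: "c > 0"
  shows "has_bochner_integral lborel (\<lambda>x::real. exp (- c * x\<^sup>2 / 2)) (sqrt (2 * pi / c))"
proof -
  have "has_bochner_integral lborel (\<lambda>x. sqrt (2 * pi / c) * normal_density 0 (1 / sqrt c) x) (sqrt (2 * pi / c) * 1)"
    using c by (intro has_bochner_integral_mult_right) (auto simp: has_bochner_integral_iff)
  also have "(\<lambda>x. sqrt (2 * pi / c) * normal_density 0 (1 / sqrt c) x) = (\<lambda>x::real. exp (- c * x\<^sup>2 / 2))"
    using c by (auto simp: normal_density_def fun_eq_iff field_simps power_divide real_sqrt_divide real_sqrt_mult)
  finally show ?thesis by simp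
qed

context real_distribution
begin

text \<open>The expectation is the error factor in the second-order expansion
  \<open>char_approx3\<close>. The integrand tends to 0 pointwise and is dominated by
  \<open>6 * x^2\<close>, so a second moment suffices.\<close>

lemma char_remainder_tendsto:
  assumes "integrable M (\<lambda>x. x\<^sup>2)" and X: "X \<longlonglongrightarrow> 0"
  shows "(\<lambda>n::nat. expectation (\<lambda>x. min (6 * x\<^sup>2) (\<bar>X n\<bar> * \<bar>x\<bar> ^ 3))) \<longlonglongrightarrow> 0"
proof -
  have "(\<lambda>n. min (6 * x\<^sup>2) (\<bar>X n\<bar> * \<bar>x\<bar> ^ 3)) \<longlonglongrightarrow> min (6 * x\<^sup>2) (\<bar>0\<bar> * \<bar>x\<bar> ^ 3)" for x :: real
    by (intro tendsto_intros X)
  then have "(\<lambda>n. min (6 * x\<^sup>2) (\<bar>X n\<bar> * \<bar>x\<bar> ^ 3)) \<longlonglongrightarrow> 0" for x :: real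
    by simp
  then have "(\<lambda>n. expectation (\<lambda>x. min (6 * x\<^sup>2) (\<bar>X n\<bar> * \<bar>x\<bar> ^ 3))) \<longlonglongrightarrow> expectation (\<lambda>x. 0)"
    using assms(1) by (intro integral_dominated_convergence[where w="\<lambda>x. 6 * x\<^sup>2"]) auto
  then show ?thesis by simp
qed

text \<open>The central limit theorem for characteristic functions: to second order the base is
  \<open>1 - v * s^2 / (2 * n)\<close>, and the powers of the two bases differ by at most
  \<open>n\<close> times the difference of the bases.\<close>

lemma char_power_tendsto:
  assumes "integrable M (\<lambda>x. x)" "expectation (\<lambda>x. x) = 0"
    and "integrable M (\<lambda>x. x\<^sup>2)" "expectation (\<lambda>x. x\<^sup>2) = v"
  shows "(\<lambda>n. char M (s / sqrt n) ^ n) \<longlonglongrightarrow> complex_of_real (exp (- v * s\<^sup>2 / 2))"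
proof -
  define g where "g n = s\<^sup>2 / 6 * expectation (\<lambda>x. min (6 * x\<^sup>2) (\<bar>s / sqrt n\<bar> * \<bar>x\<bar> ^ 3))" for n :: nat
  have v: "v \<ge> 0" unfolding assms(4)[symmetric] by simp
  have lim: "(\<lambda>n. s / sqrt (real n)) \<longlonglongrightarrow> 0"
    by (intro tendsto_divide_0[OF tendsto_const] filterlim_at_top_imp_at_infinity
         sqrt_at_top[THEN filterlim_compose] filterlim_real_sequentially)
  have g: "g \<longlonglongrightarrow> 0"
    unfolding g_def by (intro tendsto_mult_right_zero char_remainder_tendsto assms lim)
  have "\<forall>\<^sub>F n in sequentially. cmod (char M (s / sqrt n) ^ n - complex_of_real ((1 + (- v * s\<^sup>2 / 2) / n) ^ n)) \<le> g n"
    \<comment> \<open>From this \<open>n\<close> on the real base lies between 1/2 and 1, as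
      \<open>norm_power_diff\<close> requires modulus at most 1.\<close>
    using eventually_ge_at_top[of "nat \<lceil>v * s\<^sup>2\<rceil>"] eventually_gt_at_top[of 0]
  proof eventually_elim
    case (elim n)
    then have n: "v * s\<^sup>2 \<le> n" "n > 0" by linarith+
    define q where "q = v * s\<^sup>2 / n"
    have "q \<le> 1" "q \<ge> 0" using n v by (simp_all add: q_def)
    moreover have "(- v * s\<^sup>2 / 2) / n = - (q / 2)" by (simp add: q_def)
    ultimately have le: "\<bar>1 + (- v * s\<^sup>2 / 2) / n\<bar> \<le> 1" by linarith
    have "cmod (char M (s / sqrt n) ^ n - complex_of_real (1 + (- v * s\<^sup>2 / 2) / n) ^ n) \<le>
        n * cmod (char M (s / sqrt n) - complex_of_real (1 + (- v * s\<^sup>2 / 2) / n))"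
      by (intro norm_power_diff cmod_char_le_1) (simp only: norm_of_real le)
    also have "cmod (char M (s / sqrt n) - complex_of_real (1 + (- v * s\<^sup>2 / 2) / n)) \<le> g n / n"
      using char_approx3[OF assms(1-3), of v "s / sqrt n"] assms(2,4) n
      by (simp add: g_def power_divide field_simps)
    finally show ?case using n by (simp add: mult_left_mono)
  qed
  then have "(\<lambda>n. char M (s / sqrt n) ^ n - complex_of_real ((1 + (- v * s\<^sup>2 / 2) / n) ^ n)) \<longlonglongrightarrow> 0"
    by (rule Lim_null_comparison) (rule g)
  moreover have "(\<lambda>n. complex_of_real ((1 + (- v * s\<^sup>2 / 2) / n) ^ n)) \<longlonglongrightarrow> complex_of_real (exp (- v * s\<^sup>2 / 2))"
    by (rule isCont_tendsto_compose[OF _ tendsto_exp_limit_sequentially]) auto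
  ultimately show ?thesis
    by (rule Lim_transform[rotated])
qed

text \<open>A variance \<open>v\<close> controls \<open>char M\<close> near \<open>0\<close>; away from \<open>0\<close> compactness and the
  non-lattice condition do.\<close>

lemma char_gauss_bound:
  assumes "integrable M (\<lambda>x. x)" "expectation (\<lambda>x. x) = 0"
    and "integrable M (\<lambda>x. x\<^sup>2)" "expectation (\<lambda>x. x\<^sup>2) = v" "v > 0"
    and nl: "\<And>t. t \<noteq> 0 \<Longrightarrow> cmod (char M t) \<noteq> 1"
  obtains c where "c > 0" "\<And>t. \<bar>t\<bar> \<le> A \<Longrightarrow> cmod (char M t) \<le> exp (- c * t\<^sup>2)"
proof -
  define g where "g t = expectation (\<lambda>x. min (6 * x\<^sup>2) (\<bar>t\<bar> * \<bar>x\<bar> ^ 3))" for t :: real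
  have "isCont g 0"
    unfolding continuous_at_sequentially
  proof safe
    fix X :: "nat \<Rightarrow> real" assume "X \<longlonglongrightarrow> 0"
    moreover have "g 0 = 0" by (simp add: g_def)
    ultimately show "(g \<circ> X) \<longlonglongrightarrow> g 0"
      using char_remainder_tendsto[OF assms(3), of X] by (simp add: g_def comp_def)
  qed
  then have "(g \<longlongrightarrow> 0) (at 0)"
    by (simp add: isCont_def g_def)
  \<comment> \<open>With \<open>g t < 3/2 * v\<close> the expansion error is at most
    \<open>v * t^2 / 4\<close>, half of the quadratic term, so a decay rate of \<open>v / 4\<close>
    survives. The second condition below keeps \<open>1 - t^2 * v / 2\<close> positive, hence equal
    to its modulus.\<close>
  then have "\<forall>\<^sub>F t in at 0. g t < 3 / 2 * v"
    using \<open>v > 0\<close> by (intro order_tendstoD) auto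
  moreover have "((\<lambda>t::real. t\<^sup>2 * v / 2) \<longlongrightarrow> 0\<^sup>2 * v / 2) (at 0)"
    by (intro tendsto_intros) auto
  then have "\<forall>\<^sub>F t in at (0::real). t\<^sup>2 * v / 2 < 1"
    by (intro order_tendstoD) auto
  ultimately have "\<forall>\<^sub>F t in at 0. g t < 3 / 2 * v \<and> t\<^sup>2 * v / 2 < 1"
    by eventually_elim auto
  then obtain \<delta> where \<delta>: "\<delta> > 0" "\<And>t. t \<noteq> 0 \<Longrightarrow> \<bar>t\<bar> < \<delta> \<Longrightarrow> g t < 3 / 2 * v \<and> t\<^sup>2 * v / 2 < 1"
    unfolding eventually_at by (auto simp: dist_real_def)
  have near: "cmod (char M t) \<le> exp (- (v / 4) * t\<^sup>2)" if t: "\<bar>t\<bar> < \<delta>" for t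
  proof (cases "t = 0")
    case False
    have "cmod (char M t) \<le> cmod (char M t - (1 - t\<^sup>2 * v / 2)) + cmod (complex_of_real (1 - t\<^sup>2 * v / 2))"
      using norm_triangle_ineq[of "char M t - complex_of_real (1 - t\<^sup>2 * v / 2)" "complex_of_real (1 - t\<^sup>2 * v / 2)"] by simp
    also have "cmod (char M t - (1 - t\<^sup>2 * v / 2)) \<le> t\<^sup>2 / 6 * g t"
      using char_approx3[OF assms(1-3), of v t] assms(2,4) by (simp add: g_def)
    also have "t\<^sup>2 / 6 * g t \<le> t\<^sup>2 / 6 * (3 / 2 * v)"
      using \<delta>(2)[OF False t] by (intro mult_left_mono) auto
    also have "cmod (complex_of_real (1 - t\<^sup>2 * v / 2)) = 1 - t\<^sup>2 * v / 2"
      using \<delta>(2)[OF False t] unfolding norm_of_real by simp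
    also have "t\<^sup>2 / 6 * (3 / 2 * v) + (1 - t\<^sup>2 * v / 2) = 1 + (- (v / 4) * t\<^sup>2)"
      by (simp add: field_simps)
    also have "\<dots> \<le> exp (- (v / 4) * t\<^sup>2)"
      by (rule exp_ge_add_one_self)
    finally show ?thesis by simp
  qed (simp add: char_zero)
  \<comment> \<open>What is left is a compact set away from 0, where the modulus attains a maximum,
    which is below 1 by \<open>nl\<close>.\<close>
  define K where "K = {t. \<bar>t\<bar> \<le> A} \<inter> {t. \<delta> \<le> \<bar>t\<bar>}"
  show ?thesis
  proof (cases "K = {}")
    case True
    have "\<bar>t\<bar> < \<delta>" if "\<bar>t\<bar> \<le> A" for t
      using True that by (force simp: K_def)
    then show ?thesis
      using near \<open>v > 0\<close> by (intro that[of "v / 4"]) auto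
  next
    case False
    have "K = {-A..A} \<inter> {t. \<delta> \<le> \<bar>t\<bar>}" by (auto simp: K_def)
    then have "compact K"
      by (auto intro!: compact_Int_closed closed_Collect_le continuous_intros)
    moreover have "continuous_on K (\<lambda>t. cmod (char M t))"
      by (intro continuous_at_imp_continuous_on ballI continuous_norm isCont_char)
    ultimately obtain t0 where t0: "t0 \<in> K" "\<And>t. t \<in> K \<Longrightarrow> cmod (char M t) \<le> cmod (char M t0)"
      using continuous_attains_sup[of K] False by blast
    \<comment> \<open>The floor \<open>1/2\<close> keeps \<open>ln r\<close> meaningful even if the
      maximum is 0.\<close>
    define r where "r = max (1 / 2) (cmod (char M t0))"
    have "cmod (char M t0) < 1"
      using nl[of t0] cmod_char_le_1[of t0] t0(1) \<delta>(1) by (force simp: K_def)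
    then have r: "0 < r" "r < 1" by (auto simp: r_def)
    have "A > 0" using t0(1) \<delta>(1) by (auto simp: K_def)
    \<comment> \<open>The second entry is chosen so that
      \<open>r <= exp (- c * A^2) <= exp (- c * t^2)\<close> on \<open>K\<close>.\<close>
    define c where "c = min (v / 4) (- ln r / A\<^sup>2)"
    have "c > 0" using r \<open>v > 0\<close> \<open>A > 0\<close> by (auto simp: c_def divide_neg_pos)
    moreover have "cmod (char M t) \<le> exp (- c * t\<^sup>2)" if t: "\<bar>t\<bar> \<le> A" for t
    proof (cases "\<bar>t\<bar> < \<delta>")
      case True
      have "cmod (char M t) \<le> exp (- (v / 4) * t\<^sup>2)" by (rule near[OF True])
      also have "c * t\<^sup>2 \<le> v / 4 * t\<^sup>2" unfolding c_def by (intro mult_right_mono min.cobounded1) auto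
      then have "exp (- (v / 4) * t\<^sup>2) \<le> exp (- c * t\<^sup>2)" by simp
      finally show ?thesis .
    next
      case False
      then have "cmod (char M t) \<le> r" using t0(2)[of t] t by (auto simp: K_def r_def)
      also have "r = exp (ln r)" using r by simp
      also have "c * t\<^sup>2 \<le> (- ln r / A\<^sup>2) * A\<^sup>2"
        using t \<open>A > 0\<close> \<open>c > 0\<close> by (intro mult_mono) (auto simp: c_def abs_le_square_iff[symmetric] intro: less_imp_le)
      then have "exp (ln r) \<le> exp (- c * t\<^sup>2)" using \<open>A > 0\<close> by simp
      finally show ?thesis .
    qed
    ultimately show ?thesis by (rule that)
  qed
qed

text \<open>A Parseval identity, by Fubini. As \<open>tent\<close> vanishes outside
  \<open>[-1, 1]\<close>, only the values of \<open>char M\<close> within distance 1 of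
  \<open>\<theta>\<close> enter.\<close>

lemma expectation_tent_ft_iexp:
  "(CLINT t|M. tent_ft t * iexp (\<theta> * t)) = (CLBINT u. tent u * char M (u + \<theta>))"
proof -
  interpret pair_sigma_finite M lborel by standard
  have int: "integrable (M \<Otimes>\<^sub>M lborel) (\<lambda>(t, u). complex_of_real (tent u) * iexp ((u + \<theta>) * t))"
  proof (rule Fubini_integrable)
    show "AE x in M. integrable lborel (\<lambda>y. case (x, y) of (t, u) \<Rightarrow> complex_of_real (tent u) * iexp ((u + \<theta>) * t))"
      unfolding prod.case
      by (intro AE_I2 Bochner_Integration.integrable_bound[OF integrable_tent]) (auto simp: norm_mult)
  qed (auto simp: norm_mult)
  have "(CLINT t|M. tent_ft t * iexp (\<theta> * t)) = (CLINT t|M. (CLBINT u. tent u * iexp ((u + \<theta>) * t)))"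
  proof (intro Bochner_Integration.integral_cong refl)
    fix t
    have "complex_of_real (tent_ft t) * iexp (\<theta> * t) = (CLBINT u. tent u * iexp (t * u) * iexp (\<theta> * t))"
      unfolding integral_tent_iexp[symmetric] by simp
    also have "(\<lambda>u. tent u * iexp (t * u) * iexp (\<theta> * t)) = (\<lambda>u. tent u * iexp ((u + \<theta>) * t))"
      by (simp add: fun_eq_iff algebra_simps flip: exp_add)
    finally show "complex_of_real (tent_ft t) * iexp (\<theta> * t) = (CLBINT u. tent u * iexp ((u + \<theta>) * t))" .
  qed
  also have "\<dots> = (CLBINT u. (CLINT t|M. tent u * iexp ((u + \<theta>) * t)))"
    using Fubini_integral[OF int] by simp
  also have "\<dots> = (CLBINT u. tent u * char M (u + \<theta>))"
    by (simp add: char_def)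
  finally show ?thesis .
qed

end

text \<open>After Parseval and the substitution \<open>u = s / sqrt n - \<theta>\<close>, the
  integrand tends to \<open>tent \<theta> * exp (- v * s^2 / 2)\<close>.
  \<open>char_gauss_bound\<close> supplies a Gaussian dominating function because the compact
  support of \<open>tent\<close> confines the argument of \<open>char\<close> to a bounded
  set.\<close>

theorem tent_ft_iexp_tendsto:
  fixes N :: "nat \<Rightarrow> real measure"
  assumes "real_distribution \<mu>" "\<And>n. real_distribution (N n)"
    and char: "\<And>n t. char (N n) t = char \<mu> t ^ n"
    and mom: "integrable \<mu> (\<lambda>x. x)" "(\<integral>x. x \<partial>\<mu>) = 0" "integrable \<mu> (\<lambda>x. x\<^sup>2)" "(\<integral>x. x\<^sup>2 \<partial>\<mu>) = v" "v > 0"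
    and nl: "\<And>t. t \<noteq> 0 \<Longrightarrow> cmod (char \<mu> t) \<noteq> 1"
  shows "(\<lambda>n. sqrt n * (CLINT t|N n. tent_ft t * iexp (\<theta> * t))) \<longlonglongrightarrow> tent \<theta> * sqrt (2 * pi / v)"
proof -
  interpret \<mu>: real_distribution \<mu> by fact
  interpret N: real_distribution "N n" for n by fact
  obtain c where c: "c > 0" "\<And>t. \<bar>t\<bar> \<le> 1 + \<bar>\<theta>\<bar> \<Longrightarrow> cmod (char \<mu> t) \<le> exp (- c * t\<^sup>2)"
    using \<mu>.char_gauss_bound[OF mom nl] by metis
  define F where "F n s = complex_of_real (tent (s / sqrt n - \<theta>)) * char \<mu> (s / sqrt n) ^ n" for n :: nat and s :: real
  have [measurable]: "F n \<in> borel_measurable borel" for n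
    unfolding F_def by measurable
  have eq: "sqrt n * (CLINT t|N n. tent_ft t * iexp (\<theta> * t)) = (CLBINT s. F n s)" if n: "n > 0" for n
  proof -
    have "(CLINT t|N n. tent_ft t * iexp (\<theta> * t)) = (CLBINT u. tent u * char \<mu> (u + \<theta>) ^ n)"
      unfolding N.expectation_tent_ft_iexp char ..
    also have "\<dots> = (1 / sqrt n) *\<^sub>R (CLBINT s. F n s)"
      using n by (subst lborel_integral_real_affine[where c="1 / sqrt n" and t="-\<theta>"]) (auto simp: F_def[abs_def])
    finally show ?thesis using n by (simp add: scaleR_conv_of_real)
  qed
  have bound: "cmod (F n s) \<le> exp (- c * s\<^sup>2)" if n: "n > 0" for n s
  proof (cases "\<bar>s / sqrt n - \<theta>\<bar> \<ge> 1")
    case False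
    then have "\<bar>s / sqrt n\<bar> \<le> 1 + \<bar>\<theta>\<bar>" by linarith
    then have "cmod (char \<mu> (s / sqrt n)) ^ n \<le> exp (- c * (s / sqrt n)\<^sup>2) ^ n"
      by (intro power_mono c) auto
    also have "\<dots> = exp (- c * s\<^sup>2)"
      using n by (simp add: power_divide flip: exp_of_nat_mult)
    finally have "tent (s / sqrt n - \<theta>) * cmod (char \<mu> (s / sqrt n)) ^ n \<le> 1 * exp (- c * s\<^sup>2)"
      by (intro mult_mono tent_bounds) auto
    then show ?thesis by (simp add: F_def norm_mult norm_power tent_bounds)
  qed (simp add: F_def tent_eq_0)
  have lim: "(\<lambda>n. s / sqrt (real n)) \<longlonglongrightarrow> 0" for s
    by (intro tendsto_divide_0[OF tendsto_const] filterlim_at_top_imp_at_infinity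
         sqrt_at_top[THEN filterlim_compose] filterlim_real_sequentially)
  have "isCont tent x" for x
    using continuous_tent[of UNIV "\<lambda>x. x"] by (simp add: continuous_on_eq_continuous_at)
  then have "(\<lambda>n. tent (s / sqrt (real n) - \<theta>)) \<longlonglongrightarrow> tent (0 - \<theta>)" for s
    by (rule isCont_tendsto_compose) (intro tendsto_intros lim)
  then have "(\<lambda>n. F n s) \<longlonglongrightarrow> complex_of_real (tent (0 - \<theta>)) * complex_of_real (exp (- v * s\<^sup>2 / 2))" for s
    unfolding F_def by (intro tendsto_intros \<mu>.char_power_tendsto mom)
  then have conv: "(\<lambda>n. F (Suc n) s) \<longlonglongrightarrow> complex_of_real (tent \<theta> * exp (- v * s\<^sup>2 / 2))" for s
    by (auto simp: tent_def intro: LIMSEQ_Suc)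
  have "(\<lambda>n. CLBINT s. F (Suc n) s) \<longlonglongrightarrow> (CLBINT s. complex_of_real (tent \<theta> * exp (- v * s\<^sup>2 / 2)))"
  proof (rule integral_dominated_convergence)
    show "integrable lborel (\<lambda>s. exp (- c * s\<^sup>2))"
      using has_bochner_integral_gauss[of "2 * c"] c by (simp add: has_bochner_integral_iff)
  qed (use conv bound in auto)
  also have "(CLBINT s. complex_of_real (tent \<theta> * exp (- v * s\<^sup>2 / 2))) = tent \<theta> * sqrt (2 * pi / v)"
    using has_bochner_integral_gauss[of v] \<open>v > 0\<close> by (simp add: has_bochner_integral_iff)
  also have "(\<lambda>n. CLBINT s. F (Suc n) s) = (\<lambda>n. sqrt (Suc n) * (CLINT t|N (Suc n). tent_ft t * iexp (\<theta> * t)))"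
    by (intro ext, rule eq[symmetric]) simp
  finally show ?thesis by (rule LIMSEQ_imp_Suc)
qed

text \<open>Comparing the limit for Gaussian sums with dominated convergence yields this Fourier inversion.\<close>

lemma integral_tent_ft_iexp: "(CLBINT t. tent_ft t * iexp (\<theta> * t)) = 2 * pi * tent \<theta>"
proof -
  let ?S = std_normal_distribution
  interpret S: real_distribution ?S by (rule real_dist_normal_dist)
  \<comment> \<open>This is the law of a sum of \<open>n\<close> independent standard normal
    variables, so the previous theorem applies with \<open>v = 1\<close>.\<close>
  define N where "N n = distr ?S borel (\<lambda>x. sqrt n * x)" for n :: nat
  have N: "real_distribution (N n)" for n
    unfolding N_def by (rule S.real_distribution_distr) simp
  have "(\<lambda>n. sqrt n * (CLINT t|N n. tent_ft t * iexp (\<theta> * t))) \<longlonglongrightarrow> tent \<theta> * sqrt (2 * pi / 1)"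
  proof (rule tent_ft_iexp_tendsto[OF S.real_distribution_axioms N])
    show "char (N n) t = char ?S t ^ n" for n t
    proof -
      have "char (N n) t = char ?S (sqrt n * t)"
        by (simp add: N_def char_def integral_distr mult_ac)
      also have "\<dots> = char ?S t ^ n"
        by (simp add: char_std_normal_distribution power_mult_distrib flip: exp_of_nat_mult of_real_power)
      finally show ?thesis .
    qed
    show "integrable ?S (\<lambda>x. x)" "integrable ?S (\<lambda>x. x\<^sup>2)"
      using integrable_std_normal_distribution_moment[of 1] integrable_std_normal_distribution_moment[of 2] by simp_all
    show "(\<integral>x. x \<partial>?S) = 0"
      using integral_std_normal_distribution_moment_odd[of 1] by simp
    show "(\<integral>x. x\<^sup>2 \<partial>?S) = 1"
      using std_normal_distribution_even_moments(1)[of 1] by simp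
  qed (auto simp: char_std_normal_distribution)
  \<comment> \<open>The same sequence computed directly: \<open>sqrt n\<close> times the density of
    \<open>N n\<close> at \<open>t\<close> is \<open>std_normal_density (t / sqrt n)\<close>, which
    tends to \<open>1 / sqrt (2 * pi)\<close>.\<close>
  moreover have "(\<lambda>n. sqrt n * (CLINT t|N n. tent_ft t * iexp (\<theta> * t))) \<longlonglongrightarrow> (CLBINT t. tent_ft t * iexp (\<theta> * t)) / sqrt (2 * pi)"
  proof -
    define G where "G n t = complex_of_real (std_normal_density (t / sqrt (real n))) * (complex_of_real (tent_ft t) * iexp (\<theta> * t))" for n t
    have [measurable]: "G n \<in> borel_measurable borel" for n unfolding G_def by measurable
    have eq: "sqrt n * (CLINT t|N n. tent_ft t * iexp (\<theta> * t)) = (CLBINT t. G n t)" if n: "n > 0" for n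
    proof -
      have "(CLBINT t. G n t) = sqrt n *\<^sub>R (CLBINT t. G n (0 + sqrt n * t))"
        using n by (subst lborel_integral_real_affine[where c="sqrt n" and t=0]) auto
      also have "(CLBINT t. G n (0 + sqrt n * t)) = (CLINT t|N n. tent_ft t * iexp (\<theta> * t))"
        using n by (simp add: N_def integral_distr integral_density G_def scaleR_conv_of_real)
      finally show ?thesis by (simp add: scaleR_conv_of_real)
    qed
    have lim: "(\<lambda>n. s / sqrt (real n)) \<longlonglongrightarrow> 0" for s
      by (intro tendsto_divide_0[OF tendsto_const] filterlim_at_top_imp_at_infinity
           sqrt_at_top[THEN filterlim_compose] filterlim_real_sequentially)
    have "isCont std_normal_density x" for x
      unfolding std_normal_density_def by (intro continuous_intros) auto
    then have "(\<lambda>n. std_normal_density (t / sqrt (real n))) \<longlonglongrightarrow> std_normal_density 0" for t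
      by (rule isCont_tendsto_compose) (rule lim)
    then have "(\<lambda>n. G n t) \<longlonglongrightarrow> complex_of_real (std_normal_density 0) * (complex_of_real (tent_ft t) * iexp (\<theta> * t))" for t
      unfolding G_def by (intro tendsto_intros)
    then have conv: "(\<lambda>n. G (Suc n) t) \<longlonglongrightarrow> complex_of_real (std_normal_density 0) * (complex_of_real (tent_ft t) * iexp (\<theta> * t))" for t
      by (rule LIMSEQ_Suc)
    have le: "std_normal_density x \<le> 1" for x
    proof -
      have "1 / sqrt (2 * pi) \<le> 1"
        using pi_gt3 by (simp add: field_simps)
      then show ?thesis
        unfolding std_normal_density_def by (intro mult_le_one) auto
    qed
    have "(\<lambda>n. CLBINT t. G (Suc n) t) \<longlonglongrightarrow> (CLBINT t. complex_of_real (std_normal_density 0) * (complex_of_real (tent_ft t) * iexp (\<theta> * t)))"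
    proof (rule integral_dominated_convergence[OF _ _ integrable_tent_ft])
      show "AE t in lborel. cmod (G (Suc n) t) \<le> tent_ft t" for n
        using le tent_ft_pos by (auto simp: G_def norm_mult less_imp_le intro!: mult_left_le_one_le)
    qed (use conv in auto)
    also have "(\<lambda>n. CLBINT t. G (Suc n) t) = (\<lambda>n. sqrt (Suc n) * (CLINT t|N (Suc n). tent_ft t * iexp (\<theta> * t)))"
      by (intro ext, rule eq[symmetric]) simp
    also have "(CLBINT t. complex_of_real (std_normal_density 0) * (complex_of_real (tent_ft t) * iexp (\<theta> * t))) =
        (CLBINT t. tent_ft t * iexp (\<theta> * t)) / sqrt (2 * pi)"
      by (simp add: std_normal_density_def)
    finally show ?thesis by (rule LIMSEQ_imp_Suc)
  qed
  ultimately have "(CLBINT t. tent_ft t * iexp (\<theta> * t)) / sqrt (2 * pi) = tent \<theta> * sqrt (2 * pi / 1)"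
    by (rule LIMSEQ_unique[rotated])
  then have "(CLBINT t. tent_ft t * iexp (\<theta> * t)) = tent \<theta> * (complex_of_real (sqrt (2 * pi)) * complex_of_real (sqrt (2 * pi)))"
    by (simp add: field_simps)
  also have "complex_of_real (sqrt (2 * pi)) * complex_of_real (sqrt (2 * pi)) = 2 * pi"
    unfolding of_real_mult[symmetric] by simp
  finally show ?thesis by (simp add: mult_ac)
qed

section \<open>A local limit theorem\<close>

text \<open>Weighting by \<open>tent_ft\<close> and normalising turns the laws into probability
  measures \<open>Q n\<close> that converge weakly to \<open>P\<close>. Testing against
  \<open>h / tent_ft\<close> and restoring the total mass \<open>m n\<close>, of order
  \<open>1 / sqrt n\<close>, recovers the integrals of \<open>h\<close>.\<close>

theorem local_limit:
  fixes N :: "nat \<Rightarrow> real measure" and h :: "real \<Rightarrow> real"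
  assumes "real_distribution \<mu>" "\<And>n. real_distribution (N n)"
    and char: "\<And>n t. char (N n) t = char \<mu> t ^ n"
    and mom: "integrable \<mu> (\<lambda>x. x)" "(\<integral>x. x \<partial>\<mu>) = 0" "integrable \<mu> (\<lambda>x. x\<^sup>2)" "(\<integral>x. x\<^sup>2 \<partial>\<mu>) = v" "v > 0"
    and nl: "\<And>t. t \<noteq> 0 \<Longrightarrow> cmod (char \<mu> t) \<noteq> 1"
    and h [measurable]: "h \<in> borel_measurable borel"
    and h_cont: "AE x in lborel. isCont h x"
    and h_bound: "\<And>x. \<bar>h x\<bar> \<le> B / (1 + x\<^sup>2)"
  shows "(\<lambda>n. sqrt n * (\<integral>x. h x \<partial>N n)) \<longlonglongrightarrow> (LBINT x. h x) / sqrt (2 * pi * v)"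
proof -
  interpret \<mu>: real_distribution \<mu> by fact
  interpret N: real_distribution "N n" for n by fact
  note lim = tent_ft_iexp_tendsto[OF assms(1-8) nl]
  define m where "m n = (\<integral>t. tent_ft t \<partial>N n)" for n
  have int: "integrable (N n) tent_ft" for n
    by (rule N.integrable_const_bound[where B=16]) (auto simp: tent_ft_le less_imp_le[OF tent_ft_pos])
  have m_pos: "m n > 0" for n
  proof -
    have "m n \<noteq> 0"
    proof
      assume "m n = 0"
      then have "AE x in N n. tent_ft x = 0"
        using int by (subst (asm) m_def, subst (asm) integral_nonneg_eq_0_iff_AE)
          (auto simp: less_imp_le[OF tent_ft_pos])
      moreover have "tent_ft x \<noteq> 0" for x using tent_ft_pos[of x] by simp
      ultimately show False by simp
    qed
    moreover have "m n \<ge> 0"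
      unfolding m_def by (intro integral_nonneg_AE) (auto simp: less_imp_le[OF tent_ft_pos])
    ultimately show ?thesis by simp
  qed
  have m_lim: "(\<lambda>n. sqrt n * m n) \<longlonglongrightarrow> sqrt (2 * pi / v)"
  proof -
    have "(\<lambda>n. complex_of_real (sqrt n * m n)) \<longlonglongrightarrow> complex_of_real (sqrt (2 * pi / v))"
      using lim[of 0] by (simp add: m_def tent_def)
    then show ?thesis by (simp only: tendsto_of_real_iff)
  qed
  define Q where "Q n = density (N n) (\<lambda>t. tent_ft t / m n)" for n
  define P where "P = density lborel (\<lambda>t. tent_ft t / (2 * pi))"
  have Q_int: "(\<integral>t. f t \<partial>Q n) = (\<integral>t. tent_ft t *\<^sub>R f t \<partial>N n) /\<^sub>R m n"
    if [measurable]: "f \<in> borel_measurable borel" for n and f :: "real \<Rightarrow> 'b :: {banach, second_countable_topology}"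
  proof -
    have "(\<integral>t. f t \<partial>Q n) = (\<integral>t. (1 / m n) *\<^sub>R (tent_ft t *\<^sub>R f t) \<partial>N n)"
      using m_pos[of n] tent_ft_pos by (auto simp: Q_def integral_density less_imp_le)
    then show ?thesis by (simp only: integral_scaleR_right inverse_eq_divide)
  qed
  have P_int: "(\<integral>t. f t \<partial>P) = (\<integral>t. tent_ft t *\<^sub>R f t \<partial>lborel) /\<^sub>R (2 * pi)"
    if [measurable]: "f \<in> borel_measurable borel" for f :: "real \<Rightarrow> 'b :: {banach, second_countable_topology}"
  proof -
    have "(\<integral>t. f t \<partial>P) = (\<integral>t. (1 / (2 * pi)) *\<^sub>R (tent_ft t *\<^sub>R f t) \<partial>lborel)"
      using tent_ft_pos by (auto simp: P_def integral_density less_imp_le)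
    then show ?thesis by (simp only: integral_scaleR_right inverse_eq_divide)
  qed
  have Q: "real_distribution (Q n)" for n
  proof -
    have "emeasure (Q n) UNIV = ennreal (m n / m n)"
      using m_pos[of n] tent_ft_pos int[of n]
      by (auto simp: Q_def emeasure_density nn_integral_eq_integral less_imp_le m_def)
    then have "prob_space (Q n)"
      using m_pos[of n] by (intro prob_spaceI) (simp add: Q_def)
    then show ?thesis
      by (simp add: real_distribution_def real_distribution_axioms_def Q_def)
  qed
  have tent_ft_total: "(LBINT t. tent_ft t) = 2 * pi"
  proof -
    have "complex_of_real (LBINT t. tent_ft t) = complex_of_real (2 * pi)"
      using integral_tent_ft_iexp[of 0] by (simp add: tent_def)
    then show ?thesis by (simp only: of_real_eq_iff)
  qed
  have P: "real_distribution P"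
  proof -
    have "emeasure P UNIV = ennreal ((LBINT t. tent_ft t) / (2 * pi))"
      using tent_ft_pos integrable_tent_ft
      by (auto simp: P_def emeasure_density nn_integral_eq_integral less_imp_le)
    then have "prob_space P"
      by (intro prob_spaceI) (simp add: P_def tent_ft_total)
    then show ?thesis
      by (simp add: real_distribution_def real_distribution_axioms_def P_def)
  qed
  interpret P: real_distribution P by (rule P)
  have weak: "weak_conv_m Q P"
  proof (rule levy_continuity[OF Q P])
    fix \<theta>
    \<comment> \<open>Dividing the limit at \<open>\<theta>\<close> by the one at 0 cancels
      \<open>sqrt n\<close> and leaves \<open>tent \<theta>\<close>, which is
      \<open>char P \<theta>\<close> by Fourier inversion.\<close>
    have "(\<lambda>n. (sqrt n * (CLINT t|N n. tent_ft t * iexp (\<theta> * t))) / complex_of_real (sqrt n * m n))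
        \<longlonglongrightarrow> complex_of_real (tent \<theta> * sqrt (2 * pi / v)) / complex_of_real (sqrt (2 * pi / v))"
      using \<open>v > 0\<close> by (intro tendsto_divide lim tendsto_of_real m_lim) auto
    also have "complex_of_real (tent \<theta> * sqrt (2 * pi / v)) / complex_of_real (sqrt (2 * pi / v)) = char P \<theta>"
      using \<open>v > 0\<close> by (simp add: char_def P_int scaleR_conv_of_real integral_tent_ft_iexp[simplified])
    finally show "(\<lambda>n. char (Q n) \<theta>) \<longlonglongrightarrow> char P \<theta>"
      by (rule Lim_transform_eventually)
         (use eventually_gt_at_top[of 0] in eventually_elim,
          simp add: char_def Q_int scaleR_conv_of_real divide_inverse)
  qed
  define f where "f x = h x / tent_ft x" for x
  have [measurable]: "f \<in> borel_measurable borel" unfolding f_def by measurable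
  have kf: "tent_ft x * f x = h x" for x using tent_ft_pos[of x] by (simp add: f_def)
  have "(\<lambda>n. \<integral>x. f x \<partial>Q n) \<longlonglongrightarrow> (\<integral>x. f x \<partial>P)"
  proof (rule weak_conv_imp_bdd_ae_continuous_conv[OF Q P weak])
    \<comment> \<open>Excluding the null point 0 lets continuity of \<open>tent_ft\<close> be read
      off from its quotient formula.\<close>
    have "AE x in lborel. x \<noteq> 0 \<longrightarrow> isCont h x \<longrightarrow> isCont f x"
    proof (intro AE_I2 impI)
      fix x :: real assume "x \<noteq> 0" "isCont h x"
      have "isCont (\<lambda>t. 4 * (t - sin t) / t ^ 3) x" using \<open>x \<noteq> 0\<close> by (intro continuous_intros) auto
      moreover have "\<forall>\<^sub>F t in nhds x. tent_ft t = 4 * (t - sin t) / t ^ 3"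
        using t1_space_nhds[OF \<open>x \<noteq> 0\<close>] by eventually_elim (simp add: tent_ft_def)
      ultimately have "isCont tent_ft x" by (subst isCont_cong)
      then show "isCont f x"
        unfolding f_def using \<open>isCont h x\<close> tent_ft_pos[of x] by (intro continuous_intros) auto
    qed
    then have "AE x in lborel. isCont f x"
      using h_cont AE_lborel_singleton[of 0] by eventually_elim auto
    then have "AE x in P. isCont f x"
      unfolding P_def by (subst AE_density) auto
    then show "P {x. \<not> isCont f x} = 0"
      by (subst (asm) AE_iff_measurable[OF _ refl]) auto
    show "norm (f x) \<le> B * 5 / 2" for x
    proof -
      have "B \<ge> 0" using h_bound[of 0] abs_ge_zero[of "h 0"] by simp
      have "\<bar>h x\<bar> \<le> (B * 5 / 2) * (2 / 5 / (1 + x\<^sup>2))"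
      proof -
        have "(B * 5 / 2) * (2 / 5 / d) = B / d" for d :: real by simp
        then show ?thesis using h_bound[of x] by (simp only:)
      qed
      also have "\<dots> \<le> (B * 5 / 2) * tent_ft x"
        using \<open>B \<ge> 0\<close> by (intro mult_left_mono tent_ft_lower) auto
      finally show ?thesis
        using tent_ft_pos[of x] by (simp add: f_def divide_le_eq)
    qed
  qed auto
  \<comment> \<open>Multiplying by the mass undoes the normalisation: \<open>m n\<close> cancels on
    the left, and the constants on the right combine to
    \<open>1 / sqrt (2 * pi * v)\<close>.\<close>
  then have "(\<lambda>n. (sqrt n * m n) * ((\<integral>x. h x \<partial>N n) / m n)) \<longlonglongrightarrow> sqrt (2 * pi / v) * ((LBINT x. h x) / (2 * pi))"
    by (intro tendsto_mult m_lim) (simp add: Q_int P_int kf inverse_eq_divide)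
  also have "(\<lambda>n. (sqrt n * m n) * ((\<integral>x. h x \<partial>N n) / m n)) = (\<lambda>n. sqrt n * (\<integral>x. h x \<partial>N n))"
  proof
    show "(sqrt n * m n) * ((\<integral>x. h x \<partial>N n) / m n) = sqrt n * (\<integral>x. h x \<partial>N n)" for n
      using m_pos[of n] by simp
  qed
  also have "sqrt (2 * pi / v) * ((LBINT x. h x) / (2 * pi)) = (LBINT x. h x) / sqrt (2 * pi * v)"
  proof -
    define r where "r = sqrt (2 * pi)"
    have r: "r > 0" "2 * pi = r * r" by (simp_all add: r_def)
    have "sqrt (2 * pi / v) = r / sqrt v" "sqrt (2 * pi * v) = r * sqrt v"
      by (simp_all add: r_def real_sqrt_divide real_sqrt_mult)
    then show ?thesis using r by simp
  qed
  finally show ?thesis .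
qed

section \<open>Moments under the exponential weight\<close>

text \<open>Quadratic Taylor bound for \<open>exp (c * \<bar>x\<bar>)\<close>. It puts exponential
  decay into the form \<open>B / (1 + x^2)\<close> used in \<open>local_limit\<close> and for
  integrability.\<close>

lemma exp_minus_abs_le:
  fixes c x :: real
  assumes "c > 0"
  shows "exp (- c * \<bar>x\<bar>) \<le> max 1 (2 / c\<^sup>2) / (1 + x\<^sup>2)"
proof -
  let ?K = "max 1 (2 / c\<^sup>2)"
  have "1 + x\<^sup>2 \<le> ?K * 1 + ?K * (c\<^sup>2 / 2 * x\<^sup>2)"
  proof -
    have "1 * x\<^sup>2 \<le> ?K * (c\<^sup>2 / 2) * x\<^sup>2"
    proof (intro mult_right_mono)
      have "2 / c\<^sup>2 * (c\<^sup>2 / 2) \<le> ?K * (c\<^sup>2 / 2)"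
        by (intro mult_right_mono) auto
      then show "1 \<le> ?K * (c\<^sup>2 / 2)" using assms by simp
    qed auto
    moreover have "1 \<le> ?K * 1" by simp
    ultimately show ?thesis by (simp only: mult.assoc)
  qed
  also have "\<dots> = ?K * (1 + (c * \<bar>x\<bar>)\<^sup>2 / 2)"
    by (simp add: power_mult_distrib distrib_left)
  also have "1 + (c * \<bar>x\<bar>)\<^sup>2 / 2 \<le> exp (c * \<bar>x\<bar>)"
    using exp_lower_Taylor_quadratic[of "c * \<bar>x\<bar>"] assms mult_nonneg_nonneg[of c "\<bar>x\<bar>"]
    by linarith
  then have "?K * (1 + (c * \<bar>x\<bar>)\<^sup>2 / 2) \<le> ?K * exp (c * \<bar>x\<bar>)"
    by (intro mult_left_mono) auto
  finally show ?thesis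
    by (simp add: exp_minus field_simps add_pos_nonneg)
qed

text \<open>A single term of the exponential series is at most the whole series.\<close>

lemma power_times_exp_le:
  fixes b y :: real
  assumes "b > 0" "y \<ge> 0"
  shows "y ^ n * exp (- b * y) \<le> fact n / b ^ n"
proof -
  have "(b * y) ^ n / fact n = (\<Sum>k\<in>{n}. (b * y) ^ k / fact k)" by simp
  also have "\<dots> \<le> (\<Sum>k. (b * y) ^ k / fact k)"
    using assms summable_exp_generic[of "b * y"]
    by (intro sum_le_suminf) (auto simp: divide_inverse mult.commute)
  also have "\<dots> = exp (b * y)"
    by (simp add: exp_def divide_inverse mult.commute)
  finally have "b ^ n * y ^ n \<le> fact n * exp (b * y)"
    by (simp add: power_mult_distrib field_simps)
  then show ?thesis
    using assms by (simp add: exp_minus field_simps)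
qed

text \<open>The set where \<open>g\<close> is nonzero is open and a null set, hence empty.\<close>

lemma continuous_nonneg_integral_0_imp_0:
  fixes g :: "real \<Rightarrow> real"
  assumes g: "continuous_on UNIV g" "\<And>x. g x \<ge> 0"
    and int: "integrable lborel g" "(LBINT x. g x) = 0"
  shows "g x = 0"
proof -
  have "AE x in lborel. g x = 0"
    using integral_nonneg_eq_0_iff_AE[OF int(1)] g(2) int(2) by auto
  then have "{x. g x \<noteq> 0} \<in> null_sets lborel"
    using g(1) by (subst AE_iff_null_sets)
      (auto intro!: borel_open open_Collect_neq continuous_intros)
  then have "negligible {x. g x \<noteq> 0}"
    by (simp add: negligible_iff_null_sets null_sets_completionI)
  moreover have "open {x. g x \<noteq> 0}"
    using g(1) by (auto intro!: open_Collect_neq continuous_intros)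
  ultimately have "{x. g x \<noteq> 0} = {}"
    using open_not_negligible by blast
  then show ?thesis by auto
qed

section \<open>Orlicz functions: growth, integrability and the derivatives of
  \<open>orlicz_phi\<close>\<close>

locale orlicz =
  fixes M :: "real \<Rightarrow> real"
  assumes orlicz: "orlicz_function M"
begin

lemma convex: "convex_on UNIV M" and even [simp]: "M (- t) = M t"
  and zero [simp]: "M 0 = 0" and pos: "t \<noteq> 0 \<Longrightarrow> M t > 0"
  using orlicz by (auto simp: orlicz_function_def)

lemma nonneg [simp]: "M t \<ge> 0"
  using pos[of t] by (cases "t = 0") auto

lemma continuous: "continuous_on UNIV M"
  by (rule convex_on_continuous[OF open_UNIV convex])

lemma continuous' [continuous_intros]: "continuous_on S f \<Longrightarrow> continuous_on S (\<lambda>x. M (f x))"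
  using continuous_on_compose2[OF continuous] by auto

lemma measurable [measurable]: "M \<in> borel_measurable borel"
  by (intro borel_measurable_continuous_onI continuous)

text \<open>Convexity on the segment from 0 to \<open>x\<close> gives \<open>M 1 * x <= M x\<close>
  for \<open>x > 1\<close>; subtracting 1 makes the bound trivial on \<open>[-1, 1]\<close>.\<close>

lemma lower: "M x \<ge> M 1 * (\<bar>x\<bar> - 1)"
proof -
  have M1: "M 1 > 0" by (rule pos) simp
  have *: "M x \<ge> M 1 * (x - 1)" if x: "x \<ge> 0" for x
  proof (cases "x \<le> 1")
    case True
    then have "M 1 * (x - 1) \<le> 0" using M1 by (simp add: mult_le_0_iff)
    then show ?thesis using nonneg[of x] by linarith
  next
    case False
    have "M ((1 - 1 / x) *\<^sub>R 0 + (1 / x) *\<^sub>R x) \<le> (1 - 1 / x) * M 0 + (1 / x) * M x"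
      using False by (intro convex_onD[OF convex]) auto
    then have "M 1 * x \<le> M x" using False by (simp add: field_simps)
    then show ?thesis using M1 by (simp add: algebra_simps)
  qed
  show ?thesis using *[of "\<bar>x\<bar>"] by (cases "x \<ge> 0") auto
qed

lemma unbounded: "\<exists>x. M x = y" if "y \<ge> 0"
proof -
  have M1: "M 1 > 0" by (rule pos) simp
  \<comment> \<open>Chosen so that \<open>lower\<close> gives exactly \<open>y\<close> at
    \<open>b\<close>; the intermediate value theorem does the rest.\<close>
  define b where "b = y / M 1 + 1"
  have "M b \<ge> y" using lower[of b] M1 that by (simp add: b_def)
  moreover have "b \<ge> 0" using M1 that by (simp add: b_def)
  ultimately show ?thesis
    using IVT'[of M 0 y b] that continuous continuous_on_subset by fastforce
qed

text \<open>The exponential is split into two equal halves: one absorbs the power of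
  \<open>M\<close>, the other decays exponentially in \<open>\<bar>x\<bar>\<close> by the linear
  growth of \<open>M\<close>.\<close>

lemma integrable_power_exp:
  assumes a: "a < 0"
  shows "integrable lborel (\<lambda>x. M x ^ n * exp (a * M x))"
proof -
  have M1: "M 1 > 0" by (rule pos) simp
  define c where "c = - (a / 2) * M 1"
  have c: "c > 0" using a M1 by (simp add: c_def mult_neg_pos)
  \<comment> \<open>The first factor bounds the power times half of the exponential;
    \<open>exp c\<close> pays for the \<open>- 1\<close> in \<open>lower\<close>.\<close>
  define K where "K = (fact n / (- (a / 2)) ^ n) * (exp c * (max 1 (2 / c\<^sup>2)))"
  have bound: "M x ^ n * exp (a * M x) \<le> K * (1 / (1 + x\<^sup>2))" for x
  proof -
    have "M x ^ n * exp (a * M x) = (M x ^ n * exp (- (- (a / 2)) * M x)) * exp (a / 2 * M x)"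
      by (simp add: mult.assoc flip: exp_add distrib_right)
    also have "\<dots> \<le> (fact n / (- (a / 2)) ^ n) * (exp c * (max 1 (2 / c\<^sup>2) / (1 + x\<^sup>2)))"
    proof (intro mult_mono)
      show "M x ^ n * exp (- (- (a / 2)) * M x) \<le> fact n / (- (a / 2)) ^ n"
        using a by (intro power_times_exp_le) auto
      have "a / 2 * M x \<le> a / 2 * (M 1 * (\<bar>x\<bar> - 1))"
        using a by (intro mult_left_mono_neg lower) auto
      then have "exp (a / 2 * M x) \<le> exp c * exp (- c * \<bar>x\<bar>)"
        by (simp add: c_def algebra_simps flip: exp_add)
      also have "\<dots> \<le> exp c * (max 1 (2 / c\<^sup>2) / (1 + x\<^sup>2))"
        by (intro mult_left_mono exp_minus_abs_le c) auto
      finally show "exp (a / 2 * M x) \<le> exp c * (max 1 (2 / c\<^sup>2) / (1 + x\<^sup>2))" .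
    qed (use a in \<open>auto intro!: divide_nonneg_nonneg\<close>)
    finally show ?thesis by (simp add: K_def)
  qed
  have "integrable lborel (\<lambda>x. K * (1 / (1 + x\<^sup>2)))"
    by (intro integrable_mult_right integrable_inverse_1_plus_square)
  then show ?thesis
  proof (rule Bochner_Integration.integrable_bound)
    have "norm (M x ^ n * exp (a * M x)) = M x ^ n * exp (a * M x)" for x by simp
    then show "AE x in lborel. norm (M x ^ n * exp (a * M x)) \<le> norm (K * (1 / (1 + x\<^sup>2)))"
      using order_trans[OF bound abs_ge_self] by (intro AE_I2) (simp only: real_norm_def)
  qed auto
qed

text \<open>Also the n-th derivative of \<open>mom 0\<close>, by \<open>DERIV_mom\<close>; divided
  by \<open>mom 0 a\<close> it is the n-th moment of \<open>M\<close> under the tilted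
  measure.\<close>

definition mom :: "nat \<Rightarrow> real \<Rightarrow> real" where
  "mom n a = (LBINT x. M x ^ n * exp (a * M x))"

lemma mom_0_pos: "a < 0 \<Longrightarrow> mom 0 a > 0"
proof -
  assume a: "a < 0"
  have "continuous_on UNIV (\<lambda>x. exp (a * M x))" by (intro continuous_intros)
  then have "mom 0 a \<noteq> 0"
    using continuous_nonneg_integral_0_imp_0[of "\<lambda>x. exp (a * M x)" 0] integrable_power_exp[OF a, of 0]
    by (auto simp: mom_def)
  moreover have "mom 0 a \<ge> 0" by (simp add: mom_def)
  ultimately show ?thesis by simp
qed

text \<open>Differentiation under the integral: while the increment stays below
  \<open>- a / 2\<close> in modulus, all exponents are at most \<open>a / 2 < 0\<close>, so the mean
  value inequality dominates the difference quotients by an integrable function.\<close>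

lemma DERIV_mom:
  assumes a: "a < 0"
  shows "DERIV (mom n) a :> mom (Suc n) a"
  unfolding DERIV_def tendsto_at_iff_sequentially
proof (intro allI impI)
  fix X :: "nat \<Rightarrow> real"
  assume X0: "\<forall>i. X i \<in> UNIV - {0}" and X: "X \<longlonglongrightarrow> 0"
  then have "\<forall>\<^sub>F i in sequentially. \<bar>X i\<bar> < - a / 2"
    using a order_tendstoD(2)[OF tendsto_rabs_zero[OF X], of "- a / 2"] by simp
  then obtain k where k: "\<And>i. i \<ge> k \<Longrightarrow> \<bar>X i\<bar> < - a / 2"
    by (auto simp: eventually_sequentially)
  \<comment> \<open>Dropping the first \<open>k\<close> terms makes the bound on the increments hold
    for every index.\<close>
  define Y where "Y i = X (i + k)" for i
  have Y: "Y \<longlonglongrightarrow> 0" "Y i \<noteq> 0" "\<bar>Y i\<bar> < - a / 2" for i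
    using LIMSEQ_ignore_initial_segment[OF X, of k] X0 k by (auto simp: Y_def[abs_def])
  define q where "q i x = M x ^ n * ((exp ((a + Y i) * M x) - exp (a * M x)) / Y i)" for i x
  have "(\<lambda>i. LBINT x. q i x) \<longlonglongrightarrow> (LBINT x. M x ^ Suc n * exp (a * M x))"
  proof (rule integral_dominated_convergence[where w = "\<lambda>x. M x ^ Suc n * exp (a / 2 * M x)"])
    show "integrable lborel (\<lambda>x. M x ^ Suc n * exp (a / 2 * M x))"
      using a by (intro integrable_power_exp) auto
    show "AE x in lborel. (\<lambda>i. q i x) \<longlonglongrightarrow> M x ^ Suc n * exp (a * M x)"
    proof (intro AE_I2)
      fix x
      have "DERIV (\<lambda>a. exp (a * M x)) a :> M x * exp (a * M x)"
        by (auto intro!: derivative_eq_intros)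
      then have "(\<lambda>i. (exp ((a + Y i) * M x) - exp (a * M x)) / Y i) \<longlonglongrightarrow> M x * exp (a * M x)"
        unfolding DERIV_def tendsto_at_iff_sequentially using Y by (auto simp: comp_def)
      then have "(\<lambda>i. q i x) \<longlonglongrightarrow> M x ^ n * (M x * exp (a * M x))"
        unfolding q_def by (rule tendsto_mult_left)
      then show "(\<lambda>i. q i x) \<longlonglongrightarrow> M x ^ Suc n * exp (a * M x)"
        by (simp add: mult_ac)
    qed
    show "AE x in lborel. norm (q i x) \<le> M x ^ Suc n * exp (a / 2 * M x)" for i
    proof (intro AE_I2)
      fix x
      have D: "DERIV (\<lambda>a. exp (a * M x)) z :> M x * exp (z * M x)" for z
        by (auto intro!: derivative_eq_intros)
      have "\<bar>exp ((a + Y i) * M x) - exp (a * M x)\<bar> \<le> (M x * exp (a / 2 * M x)) * \<bar>a + Y i - a\<bar>"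
      proof (rule field_differentiable_bound[where S = "{..a / 2}" and f = "\<lambda>a. exp (a * M x)" and f' = "\<lambda>z. M x * exp (z * M x)", unfolded real_norm_def])
        show "((\<lambda>a. exp (a * M x)) has_field_derivative M x * exp (z * M x)) (at z within {..a / 2})" for z
          by (rule has_field_derivative_at_within[OF D])
        show "\<bar>M x * exp (z * M x)\<bar> \<le> M x * exp (a / 2 * M x)" if "z \<in> {..a / 2}" for z
        proof -
          have "z * M x \<le> a / 2 * M x" using that by (intro mult_right_mono) auto
          then show ?thesis unfolding abs_mult by (auto intro!: mult_left_mono)
        qed
      qed (use Y(3)[of i] a in auto)
      then have "\<bar>(exp ((a + Y i) * M x) - exp (a * M x)) / Y i\<bar> \<le> M x * exp (a / 2 * M x)"
        using Y(2)[of i] by (simp add: divide_le_eq abs_divide)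
      then have "M x ^ n * \<bar>(exp ((a + Y i) * M x) - exp (a * M x)) / Y i\<bar> \<le> M x ^ n * (M x * exp (a / 2 * M x))"
        by (intro mult_left_mono) auto
      then show "norm (q i x) \<le> M x ^ Suc n * exp (a / 2 * M x)"
        by (simp add: q_def abs_mult mult_ac)
    qed
  qed (auto simp: q_def)
  moreover have "(LBINT x. q i x) = (mom n (a + Y i) - mom n a) / Y i" for i
  proof -
    have "a + Y i < 0" using Y(3)[of i] a by linarith
    have "(LBINT x. q i x) = (LBINT x. (M x ^ n * exp ((a + Y i) * M x) - M x ^ n * exp (a * M x)) / Y i)"
      by (simp add: q_def right_diff_distrib)
    then show ?thesis
      using a \<open>a + Y i < 0\<close> by (simp add: mom_def integrable_power_exp)
  qed
  ultimately have "(\<lambda>i. (mom n (a + X (i + k)) - mom n a) / X (i + k)) \<longlonglongrightarrow> mom (Suc n) a"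
    by (simp add: mom_def Y_def)
  then show "((\<lambda>h. (mom n (a + h) - mom n a) / h) \<circ> X) \<longlonglongrightarrow> mom (Suc n) a"
    unfolding comp_def by (rule LIMSEQ_offset)
qed

lemma phi_eq: "orlicz_phi M a = ln (mom 0 a)"
  by (simp add: orlicz_phi_def mom_def)

lemma DERIV_phi:
  assumes a: "a < 0"
  shows "DERIV (orlicz_phi M) a :> mom 1 a / mom 0 a"
proof -
  have "DERIV (\<lambda>a. ln (mom 0 a)) a :> 1 / mom 0 a * mom (Suc 0) a"
    by (rule DERIV_chain2[OF DERIV_ln_divide DERIV_mom]) (use mom_0_pos a in auto)
  then show ?thesis by (simp add: phi_eq[abs_def])
qed

lemma deriv_phi: "a < 0 \<Longrightarrow> deriv (orlicz_phi M) a = mom 1 a / mom 0 a"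
  by (rule DERIV_imp_deriv[OF DERIV_phi])

lemma deriv2_phi:
  assumes a: "a < 0"
  shows "deriv (deriv (orlicz_phi M)) a = mom 2 a / mom 0 a - (mom 1 a / mom 0 a)\<^sup>2"
proof (rule DERIV_imp_deriv)
  have "DERIV (\<lambda>a. mom 1 a / mom 0 a) a :> mom 2 a / mom 0 a - (mom 1 a / mom 0 a)\<^sup>2"
  proof (rule DERIV_cong[OF DERIV_divide[OF DERIV_mom DERIV_mom]])
    show "(mom (Suc 1) a * mom 0 a - mom 1 a * mom (Suc 0) a) / (mom 0 a * mom 0 a) =
        mom 2 a / mom 0 a - (mom 1 a / mom 0 a)\<^sup>2"
      using mom_0_pos[OF a] by (simp add: diff_divide_distrib power2_eq_square flip: numeral_2_eq_2)
  qed (use a mom_0_pos[OF a] in auto)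
  \<comment> \<open>A second derivative needs the formula for the first on a whole neighbourhood;
    the negative half-line is open.\<close>
  moreover have "\<forall>\<^sub>F x in nhds a. deriv (orlicz_phi M) x = mom 1 x / mom 0 x"
    using eventually_nhds_in_open[of "{..<0}" a] a by (auto elim!: eventually_mono simp: deriv_phi)
  ultimately show "DERIV (deriv (orlicz_phi M)) a :> mom 2 a / mom 0 a - (mom 1 a / mom 0 a)\<^sup>2"
    by (subst DERIV_cong_ev[OF refl _ refl])
qed

end

section \<open>The exponentially tilted measure\<close>

text \<open>With \<open>c = - \<alpha>\<close> this is the source of the factor
  \<open>1 / \<bar>\<alpha>\<bar>\<close> in the volume asymptotics.\<close>

lemma has_bochner_integral_exp_atMost_0:
  fixes c :: real
  assumes "c > 0"
  shows "has_bochner_integral lborel (\<lambda>t. if t \<le> 0 then exp (c * t) else 0) (1 / c)"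
proof -
  have "has_bochner_integral lborel (\<lambda>t. exp (- t) * indicator {0..} t) (1::real)"
    using has_bochner_integral_I0i_power_exp_m'[of 0] by simp
  then have "has_bochner_integral lborel (\<lambda>t. exp (- (0 + (- c) * t)) * indicator {0..} (0 + (- c) * t)) (1 /\<^sub>R \<bar>- c\<bar>)"
    using assms by (subst (asm) lborel_has_bochner_integral_real_affine_iff[of "- c" _ _ 0]) auto
  also have "(\<lambda>t. exp (- (0 + (- c) * t)) * indicator {0..} (0 + (- c) * t)) = (\<lambda>t. if t \<le> 0 then exp (c * t) else 0)"
    using assms by (auto simp: fun_eq_iff indicator_def mult_le_0_iff)
  finally show ?thesis using assms by (simp add: inverse_eq_divide)
qed

text \<open>Both measures agree on boxes, where the integral factorises, and this determines the
  product measure.\<close>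

lemma PiM_density_lborel:
  fixes p :: "real \<Rightarrow> real"
  assumes p [measurable]: "p \<in> borel_measurable borel" and p_nonneg: "\<And>x. p x \<ge> 0"
    and p_prob: "prob_space (density lborel p)"
  shows "Pi\<^sub>M {..<d::nat} (\<lambda>_. density lborel p) = density (Pi\<^sub>M {..<d} (\<lambda>_. lborel)) (\<lambda>x. ennreal (\<Prod>i<d. p (x i)))"
    (is "_ = ?D")
proof -
  interpret D: prob_space "density lborel p" by (rule p_prob)
  interpret product_prob_space "\<lambda>_::nat. density lborel p" "{..<d}" by standard
  interpret L: product_sigma_finite "\<lambda>_::nat. lborel :: real measure" by standard
  have [measurable_cong]: "sets (density lborel (\<lambda>x. ennreal (p x))) = sets borel" by simp
  have "?D = Pi\<^sub>M {..<d} (\<lambda>_. density lborel p)"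
  proof (rule PiM_eqI)
    fix A :: "nat \<Rightarrow> real set" assume A: "\<And>i. i \<in> {..<d} \<Longrightarrow> A i \<in> sets (density lborel (\<lambda>x. ennreal (p x)))"
    then have [measurable]: "i < d \<Longrightarrow> A i \<in> sets borel" for i by simp
    have "Pi\<^sub>E {..<d} A \<in> sets (Pi\<^sub>M {..<d} (\<lambda>_. lborel))"
      by (rule sets_PiM_I_finite) auto
    then have "emeasure ?D (Pi\<^sub>E {..<d} A) = (\<integral>\<^sup>+x. ennreal (\<Prod>i<d. p (x i)) * indicator (Pi\<^sub>E {..<d} A) x \<partial>Pi\<^sub>M {..<d} (\<lambda>_. lborel))"
      by (intro emeasure_density) auto
    also have "\<dots> = (\<integral>\<^sup>+x. (\<Prod>i<d. ennreal (p (x i)) * indicator (A i) (x i)) \<partial>Pi\<^sub>M {..<d} (\<lambda>_. lborel))"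
    proof (intro nn_integral_cong)
      fix x assume x: "x \<in> space (Pi\<^sub>M {..<d} (\<lambda>_. lborel :: real measure))"
      then have "indicator (Pi\<^sub>E {..<d} A) x = (\<Prod>i<d. indicator (A i) (x i) :: ennreal)"
        by (auto simp: indicator_def space_PiM PiE_def Pi_def)
      then show "ennreal (\<Prod>i<d. p (x i)) * indicator (Pi\<^sub>E {..<d} A) x = (\<Prod>i<d. ennreal (p (x i)) * indicator (A i) (x i))"
        by (simp add: prod.distrib p_nonneg prod_ennreal)
    qed
    also have "\<dots> = (\<Prod>i<d. \<integral>\<^sup>+x. ennreal (p x) * indicator (A i) x \<partial>lborel)"
      by (rule L.product_nn_integral_prod) auto
    also have "\<dots> = (\<Prod>i<d. emeasure (density lborel p) (A i))"
      by (intro prod.cong refl) (simp add: emeasure_density)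
    finally show "emeasure ?D (Pi\<^sub>E {..<d} A) = (\<Prod>i<d. emeasure (density lborel p) (A i))" .
  qed (auto intro!: sets_PiM_cong)
  then show ?thesis ..
qed

context orlicz
begin

definition tilted :: "real \<Rightarrow> real measure" where
  "tilted a = density lborel (\<lambda>x. exp (a * M x - orlicz_phi M a))"

lemma sets_tilted [simp, measurable_cong]: "sets (tilted a) = sets borel"
  and space_tilted [simp]: "space (tilted a) = UNIV"
  by (simp_all add: tilted_def)

lemma tilted_density:
  "a < 0 \<Longrightarrow> exp (a * M x - orlicz_phi M a) = exp (a * M x) / mom 0 a"
  using mom_0_pos[of a] by (simp add: phi_eq exp_diff)

lemma integral_tilted:
  fixes f :: "real \<Rightarrow> 'b :: {banach, second_countable_topology}"
  assumes "a < 0" and [measurable]: "f \<in> borel_measurable borel"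
  shows "(\<integral>x. f x \<partial>tilted a) = (LBINT x. (exp (a * M x) / mom 0 a) *\<^sub>R f x)"
    and "integrable (tilted a) f \<longleftrightarrow> integrable lborel (\<lambda>x. (exp (a * M x) / mom 0 a) *\<^sub>R f x)"
  using assms unfolding tilted_def
  by (simp_all add: integral_density integrable_density tilted_density[symmetric])

lemma integrable_tilted_power: "a < 0 \<Longrightarrow> integrable (tilted a) (\<lambda>x. M x ^ n)"
  using integrable_divide[OF integrable_power_exp[of a n], of "mom 0 a"]
  by (simp add: integral_tilted mult_ac)

lemma integral_tilted_power: "a < 0 \<Longrightarrow> (\<integral>x. M x ^ n \<partial>tilted a) = mom n a / mom 0 a"
  by (simp add: integral_tilted mom_def mult_ac)

lemma prob_space_tilted:
  assumes "a < 0"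
  shows "prob_space (tilted a)"
proof
  have "emeasure (tilted a) UNIV = ennreal (LBINT x. exp (a * M x) / mom 0 a)"
    using assms integrable_divide[OF integrable_power_exp[of a 0], of "mom 0 a"] mom_0_pos[of a]
    by (simp add: tilted_def tilted_density emeasure_density nn_integral_eq_integral)
  also have "(LBINT x. exp (a * M x) / mom 0 a) = 1"
    using assms mom_0_pos[of a] by (simp add: mom_def)
  finally show "emeasure (tilted a) (space (tilted a)) = 1" by simp
qed

text \<open>The tilting density is continuous and strictly positive, so the statement for Lebesgue
  measure carries over.\<close>

lemma integral_tilted_0_imp_0:
  fixes g :: "real \<Rightarrow> real"
  assumes a: "a < 0" and g: "continuous_on UNIV g" "\<And>x. g x \<ge> 0"
    and "integrable (tilted a) g" "(\<integral>x. g x \<partial>tilted a) = 0"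
  shows "g x = 0"
proof -
  have [measurable]: "g \<in> borel_measurable borel"
    by (intro borel_measurable_continuous_onI g)
  have "exp (a * M x) / mom 0 a * g x = 0"
    using assms mom_0_pos[OF a]
    by (intro continuous_nonneg_integral_0_imp_0[of "\<lambda>x. exp (a * M x) / mom 0 a * g x"])
      (auto simp: integral_tilted intro!: continuous_intros)
  then show ?thesis using mom_0_pos[OF a] by simp
qed

section \<open>The centred sum under the tilted product measure\<close>

context
  fixes a R :: real
  assumes a: "a < 0" and R: "deriv (orlicz_phi M) a = R" "R > 0"
begin

interpretation T: prob_space "tilted a" by (rule prob_space_tilted[OF a])

definition summand_law :: "real measure" where "summand_law = distr (tilted a) borel (\<lambda>x. M x - R)"

text \<open>The \<open>- R\<close> lies under the sum, so every summand is centred.\<close>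

definition sum_law :: "nat \<Rightarrow> real measure" where
  "sum_law d = distr (Pi\<^sub>M {..<d} (\<lambda>_. tilted a)) borel (\<lambda>x. \<Sum>i<d. M (x i) - R)"

lemma real_distribution_summand_law: "real_distribution summand_law"
  unfolding summand_law_def by (rule T.real_distribution_distr) simp

lemma real_distribution_sum_law: "real_distribution (sum_law d)"
  unfolding sum_law_def
  by (rule prob_space.real_distribution_distr[OF prob_space_PiM]) (auto intro: T.prob_space_axioms)

lemma char_summand_law: "char summand_law t = (CLINT x|tilted a. iexp (t * (M x - R)))"
  by (simp add: char_def summand_law_def integral_distr)

lemma char_sum_law: "char (sum_law d) t = char summand_law t ^ d"
proof -
  interpret product_prob_space "\<lambda>_::nat. tilted a" "{..<d}" by standard
  have "char (sum_law d) t = (CLINT x|Pi\<^sub>M {..<d} (\<lambda>_. tilted a). iexp (t * (\<Sum>i<d. M (x i) - R)))"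
    by (simp add: char_def sum_law_def integral_distr)
  also have "\<dots> = (CLINT x|Pi\<^sub>M {..<d} (\<lambda>_. tilted a). (\<Prod>i<d. iexp (t * (M (x i) - R))))"
    by (simp add: sum_distrib_left exp_sum)
  also have "\<dots> = (\<Prod>i<d. CLINT x|tilted a. iexp (t * (M x - R)))"
    by (rule product_integral_prod) (auto intro!: T.integrable_iexp)
  finally show ?thesis by (simp add: char_summand_law)
qed

text \<open>The choice of \<open>a\<close> with derivative \<open>R\<close> is what centres the
  summand; its variance is the second derivative of \<open>orlicz_phi M\<close>.\<close>

lemma moments_summand_law:
  "integrable summand_law (\<lambda>x. x)" "(\<integral>x. x \<partial>summand_law) = 0" "integrable summand_law (\<lambda>x. x\<^sup>2)"
  "(\<integral>x. x\<^sup>2 \<partial>summand_law) = deriv (deriv (orlicz_phi M)) a" "deriv (deriv (orlicz_phi M)) a > 0"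
proof -
  have R': "mom 1 a / mom 0 a = R" using R deriv_phi[OF a] by simp
  have U: "T.prob UNIV = 1" using T.prob_space by simp
  note i = integrable_tilted_power[OF a, of 1] integrable_tilted_power[OF a, of 2]
  note e = integral_tilted_power[OF a, of 1] integral_tilted_power[OF a, of 2]
  show "integrable summand_law (\<lambda>x. x)" "(\<integral>x. x \<partial>summand_law) = 0"
    using i e R' by (simp_all add: summand_law_def integrable_distr_eq integral_distr U)
  have sq: "(\<lambda>x. (M x - R)\<^sup>2) = (\<lambda>x. (M x)\<^sup>2 - 2 * R * M x + R\<^sup>2)"
    by (auto simp: power2_eq_square algebra_simps)
  have int: "integrable (tilted a) (\<lambda>x. (M x - R)\<^sup>2)"
    unfolding sq using i by auto
  then show "integrable summand_law (\<lambda>x. x\<^sup>2)"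
    by (simp add: summand_law_def integrable_distr_eq)
  have E: "(\<integral>x. (M x - R)\<^sup>2 \<partial>tilted a) = deriv (deriv (orlicz_phi M)) a"
    unfolding sq deriv2_phi[OF a] using i e R' by (simp add: U power2_eq_square)
  then show "(\<integral>x. x\<^sup>2 \<partial>summand_law) = deriv (deriv (orlicz_phi M)) a"
    by (simp add: summand_law_def integral_distr)
  \<comment> \<open>Zero variance would force \<open>M x = R\<close> everywhere, but
    \<open>M 0 = 0 < R\<close>.\<close>
  have "(\<integral>x. (M x - R)\<^sup>2 \<partial>tilted a) \<noteq> 0"
  proof
    assume "(\<integral>x. (M x - R)\<^sup>2 \<partial>tilted a) = 0"
    then have "(M 0 - R)\<^sup>2 = 0"
      by (intro integral_tilted_0_imp_0[OF a, of "\<lambda>x. (M x - R)\<^sup>2"] int) (auto intro!: continuous_intros)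
    then show False using R by simp
  qed
  moreover have "(\<integral>x. (M x - R)\<^sup>2 \<partial>tilted a) \<ge> 0" by simp
  ultimately show "deriv (deriv (orlicz_phi M)) a > 0"
    unfolding E by linarith
qed

text \<open>Modulus 1 would force the phase \<open>t * (M x - R)\<close> to be constant modulo
  \<open>2 * pi\<close>, while \<open>M\<close> takes every nonnegative value.\<close>

lemma nonlattice_summand_law:
  assumes "t \<noteq> 0"
  shows "cmod (char summand_law t) \<noteq> 1"
proof
  assume 1: "cmod (char summand_law t) = 1"
  define b where "b = Arg (char summand_law t)"
  have "char summand_law t \<noteq> 0" using 1 by auto
  then have b: "char summand_law t = iexp b"
    using Arg_eq[of "char summand_law t"] 1 by (simp add: b_def)
  have int: "integrable (tilted a) (\<lambda>x. iexp (t * (M x - R) - b))"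
    by (auto intro!: T.integrable_iexp)
  have "(CLINT x|tilted a. iexp (t * (M x - R) - b)) = (CLINT x|tilted a. iexp (t * (M x - R)) * iexp (- b))"
    by (simp add: right_diff_distrib flip: exp_add)
  also have "\<dots> = char summand_law t * iexp (- b)"
    by (simp add: char_summand_law)
  also have "\<dots> = iexp b * iexp (- b)"
    by (simp only: b)
  also have "\<dots> = 1" by (simp flip: exp_add)
  finally have "(\<integral>x. Re (iexp (t * (M x - R) - b)) \<partial>tilted a) = 1"
    using integral_Re[OF int] by simp
  then have cos_int: "(\<integral>x. cos (t * (M x - R) - b) \<partial>tilted a) = 1"
    by (simp add: Re_exp)
  have i: "integrable (tilted a) (\<lambda>x. cos (t * (M x - R) - b))"
    using integrable_Re[OF int] by (simp add: Re_exp)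
  have *: "1 - cos (t * (M x - R) - b) = 0" for x
  proof (rule integral_tilted_0_imp_0[OF a, of "\<lambda>x. 1 - cos (t * (M x - R) - b)"])
    show "(\<integral>x. 1 - cos (t * (M x - R) - b) \<partial>tilted a) = 0"
      using i cos_int T.prob_space by simp
  qed (use i in \<open>auto intro!: continuous_intros\<close>)
  \<comment> \<open>Moving from 0 to this point shifts the phase by \<open>pi\<close>, so the cosine
    changes sign and cannot be 1 at both.\<close>
  obtain x where x: "M x = pi / \<bar>t\<bar>" using unbounded[of "pi / \<bar>t\<bar>"] by auto
  have "t * (M x - R) - b = (t * (M 0 - R) - b) + pi \<or> t * (M x - R) - b = (t * (M 0 - R) - b) - pi"
    using assms by (cases "t > 0") (simp_all add: x field_simps)
  then have "cos (t * (M x - R) - b) = - cos (t * (M 0 - R) - b)"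
    using cos_periodic_pi cos_minus_pi by (metis)
  with *[of x] *[of 0] show False by linarith
qed

text \<open>With \<open>T\<close> the centred sum, the tilted density times
  \<open>exp (- a * T)\<close> is the constant \<open>exp (- d * (orlicz_phi M a - a * R))\<close>,
  and the ball is the event \<open>T <= 0\<close>.\<close>

lemma vol_eq:
  "vol d (orlicz_ball M d (d * R)) =
    exp (d * (orlicz_phi M a - a * R)) * (\<integral>t. (if t \<le> 0 then exp (- a * t) else 0) \<partial>sum_law d)"
proof -
  let ?L = "Pi\<^sub>M {..<d} (\<lambda>_. lborel :: real measure)"
  let ?B = "orlicz_ball M d (d * R)"
  define h where "h t = (if t \<le> 0 then exp (- a * t) else 0)" for t :: real
  have [measurable]: "h \<in> borel_measurable borel" unfolding h_def by measurable
  define p where "p x = exp (a * M x - orlicz_phi M a)" for x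
  have [measurable]: "p \<in> borel_measurable borel" unfolding p_def by measurable
  have PiM: "Pi\<^sub>M {..<d} (\<lambda>_. tilted a) = density ?L (\<lambda>x. ennreal (\<Prod>i<d. p (x i)))"
    using prob_space_tilted[OF a] unfolding tilted_def
    by (subst PiM_density_lborel) (auto simp: p_def)
  have "(\<integral>t. h t \<partial>sum_law d) = (\<integral>x. (\<Prod>i<d. p (x i)) * h (\<Sum>i<d. M (x i) - R) \<partial>?L)"
    unfolding sum_law_def by (subst integral_distr) (simp_all add: PiM integral_density prod_nonneg p_def)
  also have "\<dots> = (\<integral>x. exp (- (d * (orlicz_phi M a - a * R))) * indicator ?B x \<partial>?L)"
  proof (intro Bochner_Integration.integral_cong refl)
    fix x assume "x \<in> space ?L"
    then have "x \<in> ?B \<longleftrightarrow> (\<Sum>i<d. M (x i) - R) \<le> 0"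
      by (simp add: orlicz_ball_def space_PiM sum_subtractf)
    moreover have "(\<Prod>i<d. p (x i)) * exp (- a * (\<Sum>i<d. M (x i) - R)) = exp (- (d * (orlicz_phi M a - a * R)))"
    proof -
      have "(\<Prod>i<d. p (x i)) = exp (\<Sum>i<d. a * M (x i) - orlicz_phi M a)"
        by (simp add: p_def exp_sum)
      then have "(\<Prod>i<d. p (x i)) * exp (- a * (\<Sum>i<d. M (x i) - R)) =
         exp ((\<Sum>i<d. a * M (x i) - orlicz_phi M a) + (- a * (\<Sum>i<d. M (x i) - R)))"
        by (simp only: exp_add)
      also have "(\<Sum>i<d. a * M (x i) - orlicz_phi M a) + (- a * (\<Sum>i<d. M (x i) - R)) = - (d * (orlicz_phi M a - a * R))"
        by (simp add: sum_subtractf algebra_simps flip: sum_distrib_left)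
      finally show ?thesis .
    qed
    ultimately show "(\<Prod>i<d. p (x i)) * h (\<Sum>i<d. M (x i) - R) = exp (- (d * (orlicz_phi M a - a * R))) * indicator ?B x"
      by (simp add: h_def)
  qed
  also have "\<dots> = exp (- (d * (orlicz_phi M a - a * R))) * measure ?L (?B \<inter> space ?L)"
    by simp
  also have "?B \<inter> space ?L = ?B"
    by (auto simp: orlicz_ball_def space_PiM)
  finally have "exp (d * (orlicz_phi M a - a * R)) * (\<integral>t. h t \<partial>sum_law d) =
      exp (d * (orlicz_phi M a - a * R)) * exp (- (d * (orlicz_phi M a - a * R))) * measure ?L ?B"
    by (simp only: mult.assoc)
  also have "\<dots> = measure ?L ?B"
    by (simp only: exp_add[symmetric] add.right_inverse exp_zero mult_1)
  finally show ?thesis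
    by (simp add: vol_def h_def)
qed

text \<open>\<open>local_limit\<close> applied to the integrand \<open>h\<close> of
  \<open>vol_eq\<close>, which is continuous off 0 and decays exponentially on the negative
  half-line.\<close>

lemma vol_asymp:
  "(\<lambda>d. sqrt d * (vol d (orlicz_ball M d (d * R)) / exp (d * (orlicz_phi M a - a * R))))
    \<longlonglongrightarrow> 1 / (\<bar>a\<bar> * sqrt (2 * pi * deriv (deriv (orlicz_phi M)) a))"
proof -
  define h where "h t = (if t \<le> 0 then exp (- a * t) else 0)" for t :: real
  have [measurable]: "h \<in> borel_measurable borel" unfolding h_def by measurable
  have "(\<lambda>d. sqrt d * (\<integral>t. h t \<partial>sum_law d)) \<longlonglongrightarrow> (LBINT t. h t) / sqrt (2 * pi * deriv (deriv (orlicz_phi M)) a)"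
  proof (rule local_limit[OF real_distribution_summand_law real_distribution_sum_law char_sum_law moments_summand_law nonlattice_summand_law])
    have "isCont h x" if "x \<noteq> 0" for x
    proof (cases "x < 0")
      case True
      have "\<forall>\<^sub>F t in nhds x. h t = exp (- a * t)"
        using eventually_nhds_in_open[of "{..<0}" x] True by (auto elim!: eventually_mono simp: h_def)
      then show ?thesis by (subst isCont_cong) (auto intro!: continuous_intros)
    next
      case False
      have "\<forall>\<^sub>F t in nhds x. h t = 0"
        using eventually_nhds_in_open[of "{0<..}" x] False that by (auto elim!: eventually_mono simp: h_def)
      then show ?thesis by (subst isCont_cong) auto
    qed
    then show "AE x in lborel. isCont h x"
      using AE_lborel_singleton[of 0] by auto
    show "\<bar>h x\<bar> \<le> max 1 (2 / (- a)\<^sup>2) / (1 + x\<^sup>2)" for x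
    proof -
      have "\<bar>h x\<bar> \<le> exp (- (- a) * \<bar>x\<bar>)" by (auto simp: h_def)
      then show ?thesis using exp_minus_abs_le[of "- a" x] a by linarith
    qed
  qed auto
  also have "(LBINT t. h t) = 1 / \<bar>a\<bar>"
    using has_bochner_integral_exp_atMost_0[of "- a"] a by (simp add: has_bochner_integral_iff h_def[abs_def])
  finally show ?thesis
    by (simp add: vol_eq h_def[abs_def])
qed

end
end

text \<open>Dividing \<open>vol_asymp\<close> by its limit gives the precise asymptotics. Logarithms
  give the second claim, since the \<open>sqrt d\<close> correction vanishes after division by
  \<open>d\<close>, and exponentiating gives the first.\<close>

theorem theorem1:
  fixes R :: real and M :: "real \<Rightarrow> real" and \<alpha> \<sigma>2 :: real
  assumes "R > 0"
    and "orlicz_function M"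
    and "\<alpha> < 0"
    and "deriv (orlicz_phi M) \<alpha> = R"
    and "\<sigma>2 = deriv (deriv (orlicz_phi M)) \<alpha>"
  shows "(\<lambda>d. vol d (orlicz_ball M d (real d * R)) powr (1 / real d))
           \<longlonglongrightarrow> exp (orlicz_phi M \<alpha> - \<alpha> * R)
       \<and> (\<lambda>d. 1 / real d * ln (vol d (orlicz_ball M d (real d * R))))
           \<longlonglongrightarrow> orlicz_phi M \<alpha> - \<alpha> * R
       \<and> (\<lambda>d. vol d (orlicz_ball M d (real d * R)) /
              (1 / (\<bar>\<alpha>\<bar> * sqrt (2 * pi * real d * \<sigma>2))
                 * exp (real d * (orlicz_phi M \<alpha> - \<alpha> * R))))
           \<longlonglongrightarrow> 1"
proof -
  interpret orlicz M by standard (rule assms(2))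
  define V where "V d = vol d (orlicz_ball M d (real d * R))" for d
  define L where "L = orlicz_phi M \<alpha> - \<alpha> * R"
  define C where "C = 1 / (\<bar>\<alpha>\<bar> * sqrt (2 * pi * \<sigma>2))"
  have "\<sigma>2 > 0" using moments_summand_law(5)[OF assms(3,4,1)] assms(5) by simp
  then have C: "C > 0" using assms(3) by (simp add: C_def mult_neg_pos)
  have lim: "(\<lambda>d. sqrt d * (V d / exp (d * L))) \<longlonglongrightarrow> C"
    using vol_asymp[OF assms(3,4,1)] by (simp add: V_def L_def C_def assms(5))
  have "(\<lambda>d. sqrt d * (V d / exp (d * L)) / C) \<longlonglongrightarrow> C / C"
    by (intro tendsto_divide lim) (use C in auto)
  also have "(\<lambda>d. sqrt d * (V d / exp (d * L)) / C) = (\<lambda>d. V d / (1 / (\<bar>\<alpha>\<bar> * sqrt (2 * pi * real d * \<sigma>2)) * exp (d * L)))"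
    by (simp add: C_def real_sqrt_mult mult_ac)
  also have "C / C = 1" using C by simp
  finally have 3: "(\<lambda>d. V d / (1 / (\<bar>\<alpha>\<bar> * sqrt (2 * pi * real d * \<sigma>2)) * exp (d * L))) \<longlonglongrightarrow> 1" .
  \<comment> \<open>Positivity of the limit \<open>C\<close> makes the volumes eventually positive,
    so \<open>ln\<close> and \<open>powr\<close> can be expanded.\<close>
  have pos: "\<forall>\<^sub>F d in sequentially. V d > 0 \<and> d > 0"
    using order_tendstoD(1)[OF lim C] by eventually_elim (auto simp: zero_less_mult_iff zero_less_divide_iff)
  \<comment> \<open>This splits \<open>ln (V d) / d\<close> so that the last logarithm converges to
    \<open>ln C\<close> and is killed by its factor \<open>1 / d\<close>.\<close>
  have "(\<lambda>d. L - 1 / real d * ln (sqrt d) + 1 / real d * ln (sqrt d * (V d / exp (d * L)))) \<longlonglongrightarrow> L - 0 + 0 * ln C"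
  proof (rule tendsto_add[OF tendsto_diff[OF tendsto_const] tendsto_mult])
    show "(\<lambda>d. 1 / real d * ln (sqrt d)) \<longlonglongrightarrow> 0" by real_asymp
    show "(\<lambda>d. 1 / real d) \<longlonglongrightarrow> 0" by real_asymp
    show "(\<lambda>d. ln (sqrt d * (V d / exp (d * L)))) \<longlonglongrightarrow> ln C"
      using C by (intro tendsto_ln lim) auto
  qed
  also have "L - 0 + 0 * ln C = L" by simp
  finally have 2: "(\<lambda>d. 1 / real d * ln (V d)) \<longlonglongrightarrow> L"
  proof (rule Lim_transform_eventually)
    show "\<forall>\<^sub>F d in sequentially. L - 1 / real d * ln (sqrt d) + 1 / real d * ln (sqrt d * (V d / exp (d * L))) = 1 / real d * ln (V d)"
      using pos by eventually_elim (simp add: ln_mult ln_div field_simps)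
  qed
  have "(\<lambda>d. exp (1 / real d * ln (V d))) \<longlonglongrightarrow> exp L"
    by (intro tendsto_intros 2)
  then have 1: "(\<lambda>d. V d powr (1 / real d)) \<longlonglongrightarrow> exp L"
    by (rule Lim_transform_eventually) (use pos in eventually_elim, simp add: powr_def)
  show ?thesis
    using 1 2 3 by (simp add: V_def L_def)
qed

end
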